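(* Let $\Omega\subseteq\mathbb{R}^n$ ($n>1$) be a simply connected domain, let $v$ be a scalar-valued function on $\Omega$, and let $\underline{h}$ be a vector-valued solution on $\Omega$ of the Clifford Riccati equation $\partial_{\underline{x}} f + f^2 = v$. Let $\underline{g}$ be a differentiable vector-valued function on $\Omega$. Then the vector-valued function $\underline{f}=\underline{g}+\underline{h}$ is also a solution of $\partial_{\underline{x}} f + f^2 = v$ if and only if $\underline{g}=\dfrac{\partial_{\underline{x}}\phi}{\phi}$ for some nowhere vanishing scalar-valued solution $\phi$ of the equation \[\Delta_n\phi + 2\langle \partial_{\underline{x}}\phi,\underline{h}\rangle = 0 .\]
   Context: $\mathbb{R}_{0,n}$ is the real Clifford algebra generated by an orthonormal basis $e_1,\dots,e_n$ of $\mathbb{R}^n$ with relations $e_je_k+e_ke_j=-2\delta_{jk}$. Vectors are elements $\underline{a}=\sum_j a_je_j$, and $\langle \underline{a},\underline{b}\rangle=\sum_j a_jb_j$. The Dirac operator is $\partial_{\underline{x}}=\sum_{j=1}^n e_j\partial_{x_j}$, acting from the left; $\Delta_n=-\partial_{\underline{x}}^2$ is the Laplacian. *)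

theory Defs
  imports "HOL-Analysis.Analysis"
begin

text \<open>The generators e_j are indexed by a finite
linearly ordered type 'n (so n = CARD('n)); a multivector is a real vector indexed by
the blades, i.e. by the subsets of 'n (basis element e_A = e_{a1}...e_{ak} for
A = {a1 < ... < ak}).\<close>

type_synonym 'n mvec = "(real, 'n set) vec"
type_synonym 'n rvec = "(real, 'n) vec"

definition csign :: "('n::{finite,linorder}) set \<Rightarrow> 'n set \<Rightarrow> real" where
  "csign A B = (-1) ^ (card {(a, b). a \<in> A \<and> b \<in> B \<and> b < a} + card (A \<inter> B))"

text \<open>Clifford product, determined by e_A e_B = csign A B e_{A symdiff B}
(equivalently by e_j e_k + e_k e_j = -2 delta_jk).\<close>
definition cmult :: "('n::{finite,linorder}) mvec \<Rightarrow> 'n mvec \<Rightarrow> 'n mvec" where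
  "cmult x y = (\<chi> C. \<Sum>A\<in>UNIV. \<Sum>B\<in>UNIV.
       (if (A - B) \<union> (B - A) = C then csign A B * (x $ A) * (y $ B) else 0))"

definition cgen :: "'n \<Rightarrow> ('n::finite) mvec" where
  "cgen j = (\<chi> A. if A = {j} then 1 else 0)"

definition csc :: "real \<Rightarrow> ('n::finite) mvec" where
  "csc r = (\<chi> A. if A = {} then r else 0)"

definition cvec :: "'n rvec \<Rightarrow> ('n::finite) mvec" where
  "cvec a = (\<Sum>j\<in>UNIV. (a $ j) *\<^sub>R cgen j)"

definition cscf :: "(('n::finite) rvec \<Rightarrow> real) \<Rightarrow> 'n rvec \<Rightarrow> 'n mvec" where
  "cscf \<phi> y = csc (\<phi> y)"

definition cinner :: "('n::finite) mvec \<Rightarrow> 'n mvec \<Rightarrow> real" where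
  "cinner a b = (\<Sum>j\<in>UNIV. (a $ {j}) * (b $ {j}))"

definition has_partial :: "('n rvec \<Rightarrow> 'a::real_normed_vector) \<Rightarrow> ('n::finite) \<Rightarrow> 'n rvec \<Rightarrow> bool" where
  "has_partial F j x \<longleftrightarrow> (\<lambda>t. F (x + t *\<^sub>R axis j 1)) differentiable (at 0)"

definition cpartial :: "('n rvec \<Rightarrow> 'a::real_normed_vector) \<Rightarrow> ('n::finite) \<Rightarrow> 'n rvec \<Rightarrow> 'a" where
  "cpartial F j x = vector_derivative (\<lambda>t. F (x + t *\<^sub>R axis j 1)) (at 0)"

definition dirac :: "(('n::{finite,linorder}) rvec \<Rightarrow> 'n mvec) \<Rightarrow> 'n rvec \<Rightarrow> 'n mvec" where
  "dirac F x = (\<Sum>j\<in>UNIV. cmult (cgen j) (cpartial F j x))"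

definition riccati_solution :: "(('n::{finite,linorder}) rvec) set \<Rightarrow> ('n rvec \<Rightarrow> real) \<Rightarrow> ('n rvec \<Rightarrow> 'n rvec) \<Rightarrow> bool" where
  "riccati_solution \<Omega> v F \<longleftrightarrow>
     (\<forall>x\<in>\<Omega>. (\<forall>j. has_partial (\<lambda>y. cvec (F y)) j x) \<and>
        dirac (\<lambda>y. cvec (F y)) x + cmult (cvec (F x)) (cvec (F x)) = csc (v x))"

text \<open>Laplacian Delta_n = - d^2, as multivector-valued operator.\<close>
definition claplace :: "(('n::{finite,linorder}) rvec \<Rightarrow> real) \<Rightarrow> 'n rvec \<Rightarrow> 'n mvec" where
  "claplace \<phi> x = - dirac (dirac (cscf \<phi>)) x"

definition aux_solution :: "(('n::{finite,linorder}) rvec) set \<Rightarrow> ('n rvec \<Rightarrow> 'n rvec) \<Rightarrow> ('n rvec \<Rightarrow> real) \<Rightarrow> bool" where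
  "aux_solution \<Omega> h \<phi> \<longleftrightarrow>
     (\<forall>x\<in>\<Omega>. (\<forall>j. has_partial (cscf \<phi>) j x) \<and>
        (\<forall>j. has_partial (dirac (cscf \<phi>)) j x) \<and>
        claplace \<phi> x + csc (2 * cinner (dirac (cscf \<phi>) x) (cvec (h x))) = 0)"

end

theory Submission
  imports Defs "HOL-Complex_Analysis.Cauchy_Integral_Theorem"
begin

text \<open>Since \<open>h\<close> solves the equation, \<open>g + h\<close> does exactly when \<open>\<partial>g + g\<^sup>2 + gh + hg = 0\<close>, i.e.
  when \<open>\<partial>g\<close> is the scalar \<open>|g|\<^sup>2 + 2\<langle>g, h\<rangle>\<close>. Vanishing of the bivector part of \<open>\<partial>g\<close> means
  that \<open>g\<close> is curl free, so on the simply connected \<open>\<Omega>\<close> it is a gradient \<open>\<nabla>\<psi>\<close>, and \<open>\<phi> = e\<^sup>\<psi>\<close> has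
  \<open>\<partial>\<phi>/\<phi> = g\<close>. Conversely, for \<open>g = \<partial>\<phi>/\<phi>\<close> one has \<open>\<partial>g = \<partial>\<^sup>2\<phi>/\<phi> + |g|\<^sup>2\<close>, so the scalar equation
  for \<open>g\<close> is \<open>\<Delta>\<phi> + 2\<langle>\<partial>\<phi>, h\<rangle> = 0\<close> divided by \<open>-\<phi>\<close>.

  The potential \<open>\<psi>\<close> is obtained by continuing local potentials along paths: on balls they exist
  by Goursat's argument for fields with symmetric derivative, and the continuation is invariant
  under homotopies, hence independent of the path.\<close>

section \<open>Segment and triangle integrals\<close>

definition segment_integral :: "('a::euclidean_space \<Rightarrow> 'a) \<Rightarrow> 'a \<Rightarrow> 'a \<Rightarrow> real" where
  "segment_integral g a b = integral {0..1} (\<lambda>t. g (a + t *\<^sub>R (b - a)) \<bullet> (b - a))"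

lemma segment_point_in_closed_segment:
  fixes a b :: "'a::euclidean_space"
  assumes "t \<in> {0..1}"
  shows "a + t *\<^sub>R (b - a) \<in> closed_segment a b"
  using assms unfolding closed_segment_def
  by (auto intro!: exI[of _ t] simp: algebra_simps)

lemma continuous_on_segment_integrand:
  fixes g :: "'a::euclidean_space \<Rightarrow> 'a"
  assumes "continuous_on (closed_segment a b) g"
  shows "continuous_on {0..1} (\<lambda>t. g (a + t *\<^sub>R (b - a)) \<bullet> (b - a))"
proof -
  have "continuous_on {0..1} (g \<circ> (\<lambda>t. a + t *\<^sub>R (b - a)))"
    by (rule continuous_on_compose, intro continuous_intros,
        rule continuous_on_subset[OF assms]) (use segment_point_in_closed_segment in blast)
  then show ?thesis
    by (auto intro!: continuous_intros simp: o_def)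
qed

lemma has_integral_segment_gradient:
  fixes g :: "'a::euclidean_space \<Rightarrow> 'a"
  assumes "\<And>y. y \<in> closed_segment a b \<Longrightarrow>
     (\<Phi> has_derivative (\<lambda>h. g y \<bullet> h)) (at y within closed_segment a b)"
  shows "((\<lambda>t. g (a + t *\<^sub>R (b - a)) \<bullet> (b - a)) has_integral (\<Phi> b - \<Phi> a)) {0..1}"
proof -
  let ?p = "\<lambda>t. a + t *\<^sub>R (b - a)"
  have img: "?p ` {0..1} = closed_segment a b"
    unfolding closed_segment_def by (auto simp: algebra_simps image_def intro!: exI)
  have "((\<Phi> \<circ> ?p) has_vector_derivative (g (?p t) \<bullet> (b - a))) (at t within {0..1})"
    if t: "t \<in> {0..1}" for t
  proof -
    have "(?p has_derivative (\<lambda>s. s *\<^sub>R (b - a))) (at t within {0..1})"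
      by (auto intro!: derivative_eq_intros)
    moreover have "(\<Phi> has_derivative (\<lambda>h. g (?p t) \<bullet> h)) (at (?p t) within ?p ` {0..1})"
      using assms[OF segment_point_in_closed_segment[OF t]] img by simp
    ultimately show ?thesis
      unfolding has_vector_derivative_def by (auto dest: diff_chain_within simp: o_def)
  qed
  from fundamental_theorem_of_calculus[OF _ this]
  show ?thesis by (simp add: o_def)
qed

lemma segment_integral_subsegment:
  fixes g :: "'a::euclidean_space \<Rightarrow> 'a"
  assumes cont: "continuous_on (closed_segment a b) g"
    and u: "u \<in> {0..1}" and v: "v \<in> {0..1}"
  shows "segment_integral g (a + u *\<^sub>R (b - a)) (a + v *\<^sub>R (b - a)) =
     integral {0..v} (\<lambda>t. g (a + t *\<^sub>R (b - a)) \<bullet> (b - a)) -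
     integral {0..u} (\<lambda>t. g (a + t *\<^sub>R (b - a)) \<bullet> (b - a))"
proof -
  define f where "f = (\<lambda>t. g (a + t *\<^sub>R (b - a)) \<bullet> (b - a))"
  define F where "F = (\<lambda>\<tau>. integral {0..\<tau>} f)"
  have cf: "continuous_on {0..1} f"
    unfolding f_def by (rule continuous_on_segment_integrand[OF cont])
  let ?q = "\<lambda>s::real. u + s * (v - u)"
  have q: "?q s \<in> {0..1}" if "s \<in> {0..1}" for s
  proof -
    have "0 \<le> (1 - s) * u + s * v" using that u v by auto
    moreover have "(1 - s) * u + s * v \<le> (1 - s) * 1 + s * 1"
      using that u v by (intro add_mono mult_left_mono) auto
    ultimately show ?thesis by (simp add: algebra_simps)
  qed
  have "((F \<circ> ?q) has_vector_derivative ((v - u) *\<^sub>R f (?q s))) (at s within {0..1})"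
    if s: "s \<in> {0..1}" for s
  proof (rule vector_diff_chain_within)
    show "(?q has_vector_derivative (v - u)) (at s within {0..1})"
      by (auto intro!: derivative_eq_intros
          simp: has_real_derivative_iff_has_vector_derivative[symmetric])
    show "(F has_vector_derivative f (?q s)) (at (?q s) within ?q ` {0..1})"
      unfolding F_def
      by (rule has_vector_derivative_within_subset[OF integral_has_vector_derivative[OF cf q[OF s]]])
        (use q in auto)
  qed
  from fundamental_theorem_of_calculus[OF _ this]
  have I: "((\<lambda>s. (v - u) * f (?q s)) has_integral (F v - F u)) {0..1}"
    by (simp add: o_def)
  have eq: "g ((a + u *\<^sub>R (b - a)) + s *\<^sub>R ((a + v *\<^sub>R (b - a)) - (a + u *\<^sub>R (b - a)))) \<bullet>
              ((a + v *\<^sub>R (b - a)) - (a + u *\<^sub>R (b - a))) = (v - u) * f (?q s)" for s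
  proof -
    have "(a + u *\<^sub>R (b - a)) + s *\<^sub>R ((a + v *\<^sub>R (b - a)) - (a + u *\<^sub>R (b - a))) = a + ?q s *\<^sub>R (b - a)"
      "(a + v *\<^sub>R (b - a)) - (a + u *\<^sub>R (b - a)) = (v - u) *\<^sub>R (b - a)"
      by (simp_all add: algebra_simps)
    then show ?thesis by (simp only: f_def inner_scaleR_right)
  qed
  show ?thesis
    using integral_unique[OF I] unfolding segment_integral_def eq F_def f_def by simp
qed

lemma segment_integral_midpoint:
  fixes g :: "'a::euclidean_space \<Rightarrow> 'a"
  assumes "continuous_on (closed_segment a b) g"
  shows "segment_integral g a b =
    segment_integral g a (midpoint a b) + segment_integral g (midpoint a b) b"
proof -
  have "midpoint a b = a + (1/2) *\<^sub>R (b - a)"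
    by (simp add: midpoint_def algebra_simps flip: scaleR_add_left)
  then show ?thesis
    using segment_integral_subsegment[OF assms, of 0 1] segment_integral_subsegment[OF assms, of 0 "1/2"]
      segment_integral_subsegment[OF assms, of "1/2" 1]
    by simp
qed

lemma segment_integral_reverse:
  fixes g :: "'a::euclidean_space \<Rightarrow> 'a"
  assumes "continuous_on (closed_segment a b) g"
  shows "segment_integral g b a = - segment_integral g a b"
  using segment_integral_subsegment[OF assms, of 0 1] segment_integral_subsegment[OF assms, of 1 0]
  by simp

lemma segment_integral_const: "segment_integral (\<lambda>y. k) a b = k \<bullet> (b - a)"
  by (simp add: segment_integral_def)

lemma segment_integral_diff:
  fixes g1 g2 :: "'a::euclidean_space \<Rightarrow> 'a"
  assumes "continuous_on (closed_segment a b) g1" "continuous_on (closed_segment a b) g2"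
  shows "segment_integral (\<lambda>y. g1 y - g2 y) a b = segment_integral g1 a b - segment_integral g2 a b"
  unfolding segment_integral_def inner_diff_left
  by (rule integral_diff; rule integrable_continuous_real; rule continuous_on_segment_integrand; fact)

lemma segment_integral_bound:
  fixes g :: "'a::euclidean_space \<Rightarrow> 'a"
  assumes cont: "continuous_on (closed_segment a b) g"
    and B: "\<And>y. y \<in> closed_segment a b \<Longrightarrow> norm (g y) \<le> B" and "0 \<le> B"
  shows "\<bar>segment_integral g a b\<bar> \<le> B * norm (b - a)"
proof -
  have I: "((\<lambda>t. g (a + t *\<^sub>R (b - a)) \<bullet> (b - a)) has_integral segment_integral g a b) (cbox 0 1)"
    unfolding segment_integral_def box_real
    by (intro integrable_integral integrable_continuous_real continuous_on_segment_integrand[OF cont])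
  have "norm (segment_integral g a b) \<le> (B * norm (b - a)) * Henstock_Kurzweil_Integration.content (cbox (0::real) 1)"
  proof (rule has_integral_bound[OF _ I])
    fix t :: real assume "t \<in> cbox 0 1"
    then have "norm (g (a + t *\<^sub>R (b - a))) * norm (b - a) \<le> B * norm (b - a)"
      using B segment_point_in_closed_segment by (intro mult_right_mono) auto
    then show "norm (g (a + t *\<^sub>R (b - a)) \<bullet> (b - a)) \<le> B * norm (b - a)"
      using Cauchy_Schwarz_ineq2[of "g (a + t *\<^sub>R (b - a))" "b - a"] by simp
  qed (use \<open>0 \<le> B\<close> in simp)
  then show ?thesis by simp
qed

text \<open>An affine field with symmetric linear part is the gradient of a quadratic polynomial.\<close>

lemma segment_integral_affine:
  fixes D :: "'a::euclidean_space \<Rightarrow> 'a"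
  assumes lin: "linear D" and sym: "\<And>u w. D u \<bullet> w = D w \<bullet> u"
  shows "segment_integral (\<lambda>y. c + D (y - x)) a b =
     (c \<bullet> b + (1/2) * (D (b - x) \<bullet> (b - x))) - (c \<bullet> a + (1/2) * (D (a - x) \<bullet> (a - x)))"
proof -
  define \<Phi> where "\<Phi> = (\<lambda>z. c \<bullet> z + (1/2) * (D (z - x) \<bullet> (z - x)))"
  have bl: "bounded_linear D" using lin by (simp add: linear_conv_bounded_linear)
  have "(\<Phi> has_derivative (\<lambda>h. (c + D (y - x)) \<bullet> h)) (at y within closed_segment a b)" for y
  proof -
    have "(\<Phi> has_derivative (\<lambda>h. c \<bullet> h + (1/2) * (D h \<bullet> (y - x) + D (y - x) \<bullet> h))) (at y)"
      unfolding \<Phi>_def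
      by (auto intro!: derivative_eq_intros bounded_linear.has_derivative[OF bl])
    moreover have "(\<lambda>h. c \<bullet> h + (1/2) * (D h \<bullet> (y - x) + D (y - x) \<bullet> h)) = (\<lambda>h. (c + D (y - x)) \<bullet> h)"
      using sym by (auto simp: inner_add_left)
    ultimately show ?thesis by (auto intro: has_derivative_at_withinI)
  qed
  from has_integral_segment_gradient[of a b \<Phi> "\<lambda>y. c + D (y - x)", OF this]
  show ?thesis unfolding segment_integral_def \<Phi>_def by (simp add: integral_unique)
qed

definition triangle_integral :: "('a::euclidean_space \<Rightarrow> 'a) \<Rightarrow> 'a \<Rightarrow> 'a \<Rightarrow> 'a \<Rightarrow> real" where
  "triangle_integral g a b c = segment_integral g a b + segment_integral g b c + segment_integral g c a"

lemma continuous_on_closed_segment_in_hull: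
  assumes "continuous_on (convex hull S) g" "x \<in> convex hull S" "y \<in> convex hull S"
  shows "continuous_on (closed_segment x y) g"
  by (rule continuous_on_subset[OF assms(1) closed_segment_subset_convex_hull[OF assms(2,3)]])

lemma triangle_integral_quadrisection:
  fixes g :: "'a::euclidean_space \<Rightarrow> 'a"
  assumes cont: "continuous_on (convex hull {a,b,c}) g"
    and dist: "dist a b \<le> K" "dist b c \<le> K" "dist c a \<le> K"
    and e: "e * K^2 \<le> \<bar>triangle_integral g a b c\<bar>"
  shows "\<exists>a' b' c'.
           a' \<in> convex hull {a,b,c} \<and> b' \<in> convex hull {a,b,c} \<and> c' \<in> convex hull {a,b,c} \<and>
           dist a' b' \<le> K/2 \<and> dist b' c' \<le> K/2 \<and> dist c' a' \<le> K/2 \<and>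
           e * (K/2)^2 \<le> \<bar>triangle_integral g a' b' c'\<bar>"
    (is "\<exists>x y z. ?P x y z")
proof -
  define a' where "a' = midpoint b c"
  define b' where "b' = midpoint c a"
  define c' where "c' = midpoint a b"
  have H: "a \<in> convex hull {a,b,c}" "b \<in> convex hull {a,b,c}" "c \<in> convex hull {a,b,c}"
    by (auto intro: hull_subset[THEN subsetD])
  have H': "a' \<in> convex hull {a,b,c}" "b' \<in> convex hull {a,b,c}" "c' \<in> convex hull {a,b,c}"
    unfolding a'_def b'_def c'_def using H by (auto intro!: midpoints_in_convex_hull)
  note cs = continuous_on_closed_segment_in_hull[OF cont]
  have split: "triangle_integral g a b c = triangle_integral g a c' b' + triangle_integral g a' c' b +
      triangle_integral g a' c b' + triangle_integral g a' b' c'"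
    unfolding triangle_integral_def
    using segment_integral_reverse[OF cs[OF H'(2) H'(3)]] segment_integral_reverse[OF cs[OF H'(1) H'(3)]]
      segment_integral_reverse[OF cs[OF H'(1) H'(2)]]
      segment_integral_midpoint[OF cs[OF H(1) H(2)]] segment_integral_midpoint[OF cs[OF H(2) H(3)]]
      segment_integral_midpoint[OF cs[OF H(3) H(1)]]
    by (simp only: a'_def[symmetric] b'_def[symmetric] c'_def[symmetric])
  have K4: "e * (K/2)^2 = e * K^2 / 4" by (simp add: power_divide)
  have dm: "dist a c' = dist a b / 2" "dist c' b = dist a b / 2"
    "dist b a' = dist b c / 2" "dist a' c = dist b c / 2"
    "dist c b' = dist c a / 2" "dist b' a = dist c a / 2"
    unfolding a'_def b'_def c'_def by (simp_all add: dist_midpoint)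
  have "c' - b' = (1/2) *\<^sub>R (b - c)" "a' - c' = (1/2) *\<^sub>R (c - a)" "b' - a' = (1/2) *\<^sub>R (a - b)"
    unfolding a'_def b'_def c'_def midpoint_def by (simp_all add: algebra_simps)
  then have dm': "dist c' b' = dist b c / 2" "dist a' c' = dist c a / 2" "dist b' a' = dist a b / 2"
    by (simp_all add: dist_norm)
  then have dm'': "dist b' c' = dist b c / 2" "dist c' a' = dist c a / 2" "dist a' b' = dist a b / 2"
    by (simp_all add: dist_commute)
  have "e * K\<^sup>2 / 4 \<le> \<bar>triangle_integral g a c' b'\<bar> \<or> e * K\<^sup>2 / 4 \<le> \<bar>triangle_integral g a' c' b\<bar> \<or>
        e * K\<^sup>2 / 4 \<le> \<bar>triangle_integral g a' c b'\<bar> \<or> e * K\<^sup>2 / 4 \<le> \<bar>triangle_integral g a' b' c'\<bar>"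
    using e unfolding split by linarith
  then have "?P a c' b' \<or> ?P a' c' b \<or> ?P a' c b' \<or> ?P a' b' c'"
    using H H' dist by (simp add: dm dm' dm'' K4)
  then show ?thesis by blast
qed

lemma triangle_integral_affine:
  fixes D :: "'a::euclidean_space \<Rightarrow> 'a"
  assumes "linear D" and "\<And>u w. D u \<bullet> w = D w \<bullet> u"
  shows "triangle_integral (\<lambda>y. c + D (y - x)) a b p = 0"
  unfolding triangle_integral_def segment_integral_affine[OF assms] by simp

lemma triangle_integral_affine_approx:
  fixes g :: "'a::euclidean_space \<Rightarrow> 'a"
  assumes cont: "continuous_on (convex hull {a,b,c}) g" and "linear D" "\<And>u w. D u \<bullet> w = D w \<bullet> u"
    and approx: "\<And>y. y \<in> convex hull {a,b,c} \<Longrightarrow> norm (g y - (q + D (y - x))) \<le> B"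
  shows "\<bar>triangle_integral g a b c\<bar> \<le> B * (dist a b + dist b c + dist c a)"
proof -
  define A where "A = (\<lambda>y. q + D (y - x))"
  have bl: "bounded_linear D" using \<open>linear D\<close> by (simp add: linear_conv_bounded_linear)
  have contA: "continuous_on T A" for T
    unfolding A_def by (intro continuous_intros bounded_linear.continuous_on[OF bl])
  have H: "a \<in> convex hull {a,b,c}" "b \<in> convex hull {a,b,c}" "c \<in> convex hull {a,b,c}"
    by (auto intro: hull_subset[THEN subsetD])
  have "0 \<le> B" using approx[OF H(1)] norm_ge_zero[of "g a - (q + D (a - x))"] by linarith
  have side: "\<bar>segment_integral (\<lambda>y. g y - A y) u v\<bar> \<le> B * dist u v"
    if uv: "u \<in> convex hull {a,b,c}" "v \<in> convex hull {a,b,c}" for u v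
    unfolding dist_norm norm_minus_commute[of u]
  proof (rule segment_integral_bound)
    show "continuous_on (closed_segment u v) (\<lambda>y. g y - A y)"
      using continuous_on_closed_segment_in_hull[OF cont uv] contA by (intro continuous_intros)
    show "norm (g y - A y) \<le> B" if "y \<in> closed_segment u v" for y
      using approx closed_segment_subset_convex_hull[OF uv] that unfolding A_def by blast
  qed fact
  have "triangle_integral g a b c = triangle_integral (\<lambda>y. g y - A y) a b c + triangle_integral A a b c"
    unfolding triangle_integral_def
    using segment_integral_diff[OF continuous_on_closed_segment_in_hull[OF cont H(1) H(2)] contA]
      segment_integral_diff[OF continuous_on_closed_segment_in_hull[OF cont H(2) H(3)] contA]
      segment_integral_diff[OF continuous_on_closed_segment_in_hull[OF cont H(3) H(1)] contA]
    by simp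
  also have "triangle_integral A a b c = 0"
    unfolding A_def by (rule triangle_integral_affine) fact+
  finally show ?thesis
    unfolding triangle_integral_def distrib_left using side[OF H(1) H(2)] side[OF H(2) H(3)] side[OF H(3) H(1)]
    by linarith
qed

text \<open>Near a point where \<open>g\<close> has a symmetric derivative, \<open>g\<close> differs from an exact affine
  field by \<open>o(|y - x|)\<close>, so small triangles around the point carry integrals of order
  \<open>o(perimeter\<^sup>2)\<close>.\<close>

lemma small_triangle_integral:
  fixes g :: "'a::euclidean_space \<Rightarrow> 'a"
  assumes x: "x \<in> S" and cont: "continuous_on S g"
    and der: "(g has_derivative D) (at x within S)" and sym: "\<And>u w. D u \<bullet> w = D w \<bullet> u"
    and e: "0 < e"
  obtains k where "k > 0" "\<And>a b c. dist a b \<le> k \<Longrightarrow> dist b c \<le> k \<Longrightarrow> dist c a \<le> k \<Longrightarrow>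
      x \<in> convex hull {a,b,c} \<Longrightarrow> convex hull {a,b,c} \<subseteq> S \<Longrightarrow>
      \<bar>triangle_integral g a b c\<bar> \<le> e * (dist a b + dist b c + dist c a)^2"
proof -
  obtain d where d: "d > 0" and dd: "\<And>y. y \<in> S \<Longrightarrow> norm (y - x) < d \<Longrightarrow>
      norm (g y - g x - D (y - x)) \<le> e * norm (y - x)"
    using der e unfolding has_derivative_within_alt by meson
  show ?thesis
  proof (rule that[of "d/2"])
    show "0 < d/2" using d by simp
    fix a b c
    assume dist: "dist a b \<le> d/2" "dist b c \<le> d/2" "dist c a \<le> d/2"
      and xh: "x \<in> convex hull {a,b,c}" and hS: "convex hull {a,b,c} \<subseteq> S"
    define P where "P = dist a b + dist b c + dist c a"
    have approx: "norm (g y - (g x + D (y - x))) \<le> e * P" if y: "y \<in> convex hull {a,b,c}" for y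
    proof -
      have "norm (y - x) \<le> norm (a - b) \<or> norm (y - x) \<le> norm (b - c) \<or> norm (y - x) \<le> norm (c - a)"
        using simplex_extremal_le[of "{a,b,c}"] y xh by (auto simp: norm_minus_commute)
      then have close: "norm (y - x) \<le> P" "norm (y - x) < d"
        using dist d zero_le_dist[of a b] zero_le_dist[of b c] zero_le_dist[of c a]
        unfolding P_def dist_norm by linarith+
      have "norm (g y - (g x + D (y - x))) \<le> e * norm (y - x)"
        using dd[OF _ close(2)] y hS by (auto simp: algebra_simps)
      also have "\<dots> \<le> e * P" using close(1) e by simp
      finally show ?thesis .
    qed
    have "continuous_on (convex hull {a,b,c}) g" using cont hS continuous_on_subset by blast
    from triangle_integral_affine_approx[OF this has_derivative_linear[OF der] sym approx]
    show "\<bar>triangle_integral g a b c\<bar> \<le> e * (dist a b + dist b c + dist c a)^2"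
      unfolding P_def by (simp add: power2_eq_square mult.assoc)
  qed
qed

lemma nested_triangles:
  fixes g :: "'a::euclidean_space \<Rightarrow> 'a"
  assumes cont: "continuous_on (convex hull {a,b,c}) g"
    and dist: "dist a b \<le> K" "dist b c \<le> K" "dist c a \<le> K"
    and big: "e * K^2 \<le> \<bar>triangle_integral g a b c\<bar>"
  obtains x where "x \<in> convex hull {a,b,c}"
    "\<And>n. \<exists>a' b' c'. x \<in> convex hull {a',b',c'} \<and> convex hull {a',b',c'} \<subseteq> convex hull {a,b,c} \<and>
       dist a' b' \<le> K/2^n \<and> dist b' c' \<le> K/2^n \<and> dist c' a' \<le> K/2^n \<and>
       e * (K/2^n)^2 \<le> \<bar>triangle_integral g a' b' c'\<bar>"
proof -
  define At where "At x y z n \<longleftrightarrow>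
      convex hull {x,y,z} \<subseteq> convex hull {a,b,c} \<and>
      dist x y \<le> K/2^n \<and> dist y z \<le> K/2^n \<and> dist z x \<le> K/2^n \<and>
      \<bar>triangle_integral g x y z\<bar> \<ge> e * (K/2^n)^2"
    for x y z n
  have At0: "At a b c 0"
    using dist big by (simp add: At_def)
  have AtSuc: "\<exists>x' y' z'. At x' y' z' (Suc n) \<and> convex hull {x',y',z'} \<subseteq> convex hull {x,y,z}"
    if At: "At x y z n" for x y z n
  proof -
    have "continuous_on (convex hull {x,y,z}) g"
      using cont At At_def continuous_on_subset by metis
    from triangle_integral_quadrisection[OF this, of "K/2^n" e] At show ?thesis
      apply (simp add: At_def algebra_simps)
      apply (meson convex_hull_subset empty_subsetI insert_subset subsetCE)
      done
  qed
  obtain fa fb fc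
    where f0: "fa 0 = a" "fb 0 = b" "fc 0 = c"
      and At: "\<And>n. At (fa n) (fb n) (fc n) n"
      and nested: "\<And>n. convex hull {fa(Suc n), fb(Suc n), fc(Suc n)} \<subseteq> convex hull {fa n, fb n, fc n}"
    by (rule Chain3[of At, OF At0 AtSuc]) auto
  obtain x where x: "\<And>n. x \<in> convex hull {fa n, fb n, fc n}"
  proof (rule bounded_closed_nest)
    show "\<And>n. closed (convex hull {fa n, fb n, fc n})"
      by (simp add: compact_imp_closed finite_imp_compact_convex_hull)
    show "\<And>m n. m \<le> n \<Longrightarrow> convex hull {fa n, fb n, fc n} \<subseteq> convex hull {fa m, fb m, fc m}"
      by (erule transitive_stepwise_le) (auto simp: nested)
  qed (fastforce intro: finite_imp_bounded_convex_hull)+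
  show ?thesis
  proof (rule that)
    show "x \<in> convex hull {a,b,c}" using x[of 0] f0 by simp
    show "\<exists>a' b' c'. x \<in> convex hull {a',b',c'} \<and> convex hull {a',b',c'} \<subseteq> convex hull {a,b,c} \<and>
       dist a' b' \<le> K/2^n \<and> dist b' c' \<le> K/2^n \<and> dist c' a' \<le> K/2^n \<and>
       e * (K/2^n)^2 \<le> \<bar>triangle_integral g a' b' c'\<bar>" for n
      using x[of n] At[of n] unfolding At_def by (intro exI[of _ "fa n"] exI[of _ "fb n"] exI[of _ "fc n"]) simp
  qed
qed

text \<open>Goursat's argument, which needs only pointwise differentiability of \<open>g\<close> (differentiating
  under the integral sign would need a continuous derivative): nested triangles with integrals
  of order \<open>perimeter\<^sup>2\<close> shrink to a point, contradicting \<open>small_triangle_integral\<close> there.\<close>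

theorem triangle_integral_eq_0:
  fixes g :: "'a::euclidean_space \<Rightarrow> 'a"
  assumes cont: "continuous_on (convex hull {a,b,c}) g"
    and der: "\<And>x. x \<in> convex hull {a,b,c} \<Longrightarrow>
       \<exists>D. (g has_derivative D) (at x within convex hull {a,b,c}) \<and> (\<forall>u w. D u \<bullet> w = D w \<bullet> u)"
  shows "triangle_integral g a b c = 0"
proof (rule ccontr)
  assume nz: "triangle_integral g a b c \<noteq> 0"
  define K where "K = 1 + max (dist a b) (max (dist b c) (dist c a))"
  define e where "e = \<bar>triangle_integral g a b c\<bar> / K^2"
  have "K \<ge> 1" by (simp add: K_def max.coboundedI1)
  then have K: "K > 0" by linarith
  have e: "e > 0" unfolding e_def using nz K by simp
  have "dist a b \<le> K" "dist b c \<le> K" "dist c a \<le> K" "e * K^2 \<le> \<bar>triangle_integral g a b c\<bar>"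
    using K by (simp_all add: K_def e_def)
  then obtain x where xin: "x \<in> convex hull {a,b,c}" and shrink: "\<And>n. \<exists>a' b' c'.
      x \<in> convex hull {a',b',c'} \<and> convex hull {a',b',c'} \<subseteq> convex hull {a,b,c} \<and>
      dist a' b' \<le> K/2^n \<and> dist b' c' \<le> K/2^n \<and> dist c' a' \<le> K/2^n \<and>
      e * (K/2^n)^2 \<le> \<bar>triangle_integral g a' b' c'\<bar>"
    by (rule nested_triangles[OF cont]) blast+
  obtain D where D: "(g has_derivative D) (at x within convex hull {a,b,c})"
    and sym: "\<And>u w. D u \<bullet> w = D w \<bullet> u"
    using der[OF xin] by blast
  have "e/10 > 0" using e by simp
  then obtain k where k: "0 < k" and small: "\<And>a' b' c'. dist a' b' \<le> k \<Longrightarrow> dist b' c' \<le> k \<Longrightarrow>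
      dist c' a' \<le> k \<Longrightarrow> x \<in> convex hull {a',b',c'} \<Longrightarrow> convex hull {a',b',c'} \<subseteq> convex hull {a,b,c} \<Longrightarrow>
      \<bar>triangle_integral g a' b' c'\<bar> \<le> (e/10) * (dist a' b' + dist b' c' + dist c' a')\<^sup>2"
    by (rule small_triangle_integral[OF xin cont D sym]) blast
  obtain n where "K / k < 2 ^ n"
    using real_arch_pow[of 2 "K/k"] by auto
  then have Kn: "K / 2 ^ n < k" using k by (auto simp: field_simps)
  obtain a' b' c' where tri: "x \<in> convex hull {a',b',c'}" "convex hull {a',b',c'} \<subseteq> convex hull {a,b,c}"
    and dist: "dist a' b' \<le> K/2^n" "dist b' c' \<le> K/2^n" "dist c' a' \<le> K/2^n"
    and big: "e * (K/2^n)^2 \<le> \<bar>triangle_integral g a' b' c'\<bar>"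
    using shrink[of n] by blast
  have "dist a' b' \<le> k" "dist b' c' \<le> k" "dist c' a' \<le> k" using dist Kn by linarith+
  then have "\<bar>triangle_integral g a' b' c'\<bar> \<le> (e/10) * (dist a' b' + dist b' c' + dist c' a')\<^sup>2"
    using small tri by blast
  also have "\<dots> \<le> (e/10) * (3 * K / 2 ^ n)\<^sup>2"
    using dist K e by (intro mult_left_mono) (auto simp: abs_le_square_iff[symmetric])
  also have "\<dots> < e * (K/2^n)^2"
    using e K by (simp add: field_simps power_divide)
  finally show False using big by simp
qed

section \<open>Potentials of curl-free fields\<close>

definition curl_free_on :: "('a::euclidean_space \<Rightarrow> 'a) \<Rightarrow> 'a set \<Rightarrow> bool" where
  "curl_free_on g S \<longleftrightarrow> (\<forall>x\<in>S. \<exists>D. (g has_derivative D) (at x) \<and> (\<forall>u w. D u \<bullet> w = D w \<bullet> u))"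

definition potential_on :: "('a::euclidean_space \<Rightarrow> real) \<Rightarrow> ('a \<Rightarrow> 'a) \<Rightarrow> 'a set \<Rightarrow> bool" where
  "potential_on \<psi> g B \<longleftrightarrow> (\<forall>y\<in>B. (\<psi> has_derivative (\<lambda>h. g y \<bullet> h)) (at y))"

lemma curl_free_on_imp_continuous_on: "curl_free_on g S \<Longrightarrow> continuous_on S g"
  unfolding curl_free_on_def
  by (meson continuous_at_imp_continuous_on has_derivative_continuous)

lemma curl_free_on_subset: "curl_free_on g S \<Longrightarrow> T \<subseteq> S \<Longrightarrow> curl_free_on g T"
  unfolding curl_free_on_def by blast

lemma potential_on_subset: "potential_on \<psi> g B \<Longrightarrow> B' \<subseteq> B \<Longrightarrow> potential_on \<psi> g B'"
  unfolding potential_on_def by blast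

lemma has_derivative_segment_integral:
  fixes g :: "'a::euclidean_space \<Rightarrow> 'a"
  assumes S: "open S" "convex S" and cont: "continuous_on S g" and x: "x \<in> S"
    and \<Phi>: "\<And>y. y \<in> S \<Longrightarrow> \<Phi> y - \<Phi> x = segment_integral g x y"
  shows "(\<Phi> has_derivative (\<lambda>h. g x \<bullet> h)) (at x)"
  unfolding has_derivative_at_alt
proof (intro conjI allI impI)
  show "bounded_linear (\<lambda>h. g x \<bullet> h)" by (rule bounded_linear_inner_right)
  fix e :: real assume e: "0 < e"
  obtain r where r: "r > 0" "ball x r \<subseteq> S" using S(1) x openE by blast
  obtain d where d: "d > 0" "\<And>z. z \<in> S \<Longrightarrow> dist z x < d \<Longrightarrow> dist (g z) (g x) \<le> e"
    using cont x e unfolding continuous_on_iff by (metis less_le)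
  show "\<exists>d>0. \<forall>y. norm (y - x) < d \<longrightarrow> norm (\<Phi> y - \<Phi> x - g x \<bullet> (y - x)) \<le> e * norm (y - x)"
  proof (intro exI[of _ "min r d"] conjI allI impI)
    show "0 < min r d" using r d by simp
    fix y assume y: "norm (y - x) < min r d"
    then have yS: "y \<in> S" using r by (auto simp: dist_norm norm_minus_commute)
    have seg: "closed_segment x y \<subseteq> S" using closed_segment_subset[OF x yS S(2)] .
    have cseg: "continuous_on (closed_segment x y) g" using cont seg continuous_on_subset by blast
    have "\<Phi> y - \<Phi> x - g x \<bullet> (y - x) = segment_integral (\<lambda>z. g z - g x) x y"
      using \<Phi>[OF yS] segment_integral_diff[OF cseg continuous_on_const] segment_integral_const[of "g x" x y]
      by simp
    also have "\<bar>\<dots>\<bar> \<le> e * norm (y - x)"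
    proof (rule segment_integral_bound)
      show "continuous_on (closed_segment x y) (\<lambda>z. g z - g x)"
        using cseg by (intro continuous_intros)
      fix z assume z: "z \<in> closed_segment x y"
      have "dist z x \<le> dist x y" using segment_bound(1)[OF z] by (simp add: dist_norm norm_minus_commute)
      then have "dist z x < d" using y by (simp add: dist_norm norm_minus_commute)
      then show "norm (g z - g x) \<le> e" using d(2)[of z] z seg by (auto simp: dist_norm)
    qed (use e in simp)
    finally show "norm (\<Phi> y - \<Phi> x - g x \<bullet> (y - x)) \<le> e * norm (y - x)" by simp
  qed
qed

theorem convex_potential:
  fixes g :: "'a::euclidean_space \<Rightarrow> 'a"
  assumes S: "open S" "convex S" and c: "c \<in> S" and curl: "curl_free_on g S"
  shows "potential_on (\<lambda>y. segment_integral g c y) g S"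
  unfolding potential_on_def
proof (intro ballI has_derivative_segment_integral[OF S])
  show cont: "continuous_on S g" by (rule curl_free_on_imp_continuous_on[OF curl])
  fix x y assume x: "x \<in> S" and y: "y \<in> S"
  have hull: "convex hull {c, x, y} \<subseteq> S"
    using c x y S(2) by (simp add: hull_minimal)
  have "triangle_integral g c x y = 0"
  proof (rule triangle_integral_eq_0)
    show "continuous_on (convex hull {c, x, y}) g" using cont hull continuous_on_subset by blast
    fix z assume "z \<in> convex hull {c, x, y}"
    then obtain D where "(g has_derivative D) (at z)" "\<forall>u w. D u \<bullet> w = D w \<bullet> u"
      using curl hull unfolding curl_free_on_def by blast
    then show "\<exists>D. (g has_derivative D) (at z within convex hull {c, x, y}) \<and> (\<forall>u w. D u \<bullet> w = D w \<bullet> u)"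
      by (blast intro: has_derivative_at_withinI)
  qed
  moreover have "segment_integral g y c = - segment_integral g c y"
    by (rule segment_integral_reverse)
      (use cont closed_segment_subset[OF c y S(2)] continuous_on_subset in blast)
  ultimately show "segment_integral g c y - segment_integral g c x = segment_integral g x y"
    unfolding triangle_integral_def by linarith
qed

lemma potential_on_unique:
  assumes "potential_on \<psi>1 g B" "potential_on \<psi>2 g B" "open B" "connected B" "y \<in> B" "z \<in> B"
  shows "\<psi>1 y - \<psi>2 y = \<psi>1 z - \<psi>2 z"
proof (rule has_derivative_zero_unique_connected[OF assms(3,4) _ assms(5,6)])
  fix x assume "x \<in> B"
  then have "((\<lambda>x. \<psi>1 x - \<psi>2 x) has_derivative (\<lambda>h. g x \<bullet> h - g x \<bullet> h)) (at x)"
    using assms(1,2) unfolding potential_on_def by (intro has_derivative_diff) auto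
  then show "((\<lambda>x. \<psi>1 x - \<psi>2 x) has_derivative (\<lambda>x. 0)) (at x)" by simp
qed

lemma potential_on_unique_balls:
  assumes "potential_on \<psi>1 g (ball c1 r1)" "potential_on \<psi>2 g (ball c2 r2)"
    "y \<in> ball c1 r1" "y \<in> ball c2 r2" "z \<in> ball c1 r1" "z \<in> ball c2 r2"
  shows "\<psi>1 y - \<psi>2 y = \<psi>1 z - \<psi>2 z"
proof (rule potential_on_unique)
  show "potential_on \<psi>1 g (ball c1 r1 \<inter> ball c2 r2)" "potential_on \<psi>2 g (ball c1 r1 \<inter> ball c2 r2)"
    using assms(1,2) potential_on_subset by blast+
  show "connected (ball c1 r1 \<inter> ball c2 r2)" by (intro convex_connected convex_Int) auto
qed (use assms in auto)

lemma locally_constant_on_unit_interval: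
  fixes f :: "real \<Rightarrow> real"
  assumes "\<And>t. t \<in> {0..1} \<Longrightarrow> \<exists>e>0. \<forall>s\<in>{0..1}. \<bar>s - t\<bar> < e \<longrightarrow> f s = f t"
    and "a \<in> {0..1}" "b \<in> {0..1}"
  shows "f a = f b"
proof (rule connected_local_const[OF connected_Icc assms(2,3)])
  show "\<forall>a\<in>{0..1}. eventually (\<lambda>b. f a = f b) (at a within {0..1})"
  proof
    fix t assume "t \<in> {0..1::real}"
    then obtain e where "e > 0" "\<forall>s\<in>{0..1}. \<bar>s - t\<bar> < e \<longrightarrow> f s = f t" using assms(1) by blast
    then show "eventually (\<lambda>b. f t = f b) (at t within {0..1})"
      unfolding eventually_at by (auto simp: dist_real_def intro!: exI[of _ e])
  qed
qed

lemma unit_interval_small_steps: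
  assumes d: "d > 0" and P0: "P 0"
    and step: "\<And>s s'. s \<in> {0..1} \<Longrightarrow> s' \<in> {0..1} \<Longrightarrow> \<bar>s - s'\<bar> < d \<Longrightarrow> P s \<Longrightarrow> P s'"
  shows "P (1::real)"
proof -
  have "P (min 1 (real n * (d/2)))" for n
  proof (induction n)
    case 0 then show ?case using P0 by simp
  next
    case (Suc n)
    show ?case
      by (rule step[OF _ _ _ Suc]) (use d in \<open>auto simp: min_def algebra_simps\<close>)
  qed
  moreover obtain n where "1 \<le> real n * (d/2)"
    using real_arch_simple[of "2/d"] d by (auto simp: field_simps)
  ultimately show ?thesis by (metis min.absorb1)
qed

locale curl_free_field =
  fixes \<Omega> :: "'a::euclidean_space set" and g :: "'a \<Rightarrow> 'a"
  assumes open_domain: "open \<Omega>" and curl_free: "curl_free_on g \<Omega>"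
begin

lemma potential_on_ball:
  assumes "ball c r \<subseteq> \<Omega>"
  obtains \<psi> where "potential_on \<psi> g (ball c r)"
proof (cases "r > 0")
  case True
  then show ?thesis
    using that convex_potential[OF open_ball convex_ball _ curl_free_on_subset[OF curl_free assms], of c]
    by auto
next
  case False
  then have "ball c r = {}" by simp
  then show ?thesis by (intro that[of "\<lambda>_. 0"]) (simp add: potential_on_def \<open>ball c r = {}\<close>)
qed

text \<open>\<open>L\<close> continues a potential of \<open>g\<close> along \<open>\<gamma>\<close>: near every parameter \<open>t\<close>, \<open>L\<close> agrees
  up to a constant with some local potential evaluated along \<open>\<gamma>\<close>.\<close>

definition potential_along :: "(real \<Rightarrow> 'a) \<Rightarrow> (real \<Rightarrow> real) \<Rightarrow> bool" where
  "potential_along \<gamma> L \<longleftrightarrow> (\<forall>t\<in>{0..1}. \<exists>c r \<psi> e. ball c r \<subseteq> \<Omega> \<and> potential_on \<psi> g (ball c r) \<and> e > 0 \<and>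
      (\<forall>s\<in>{0..1}. \<bar>s - t\<bar> < e \<longrightarrow> \<gamma> s \<in> ball c r \<and> L s - \<psi> (\<gamma> s) = L t - \<psi> (\<gamma> t)))"

lemma potential_along_cong:
  "potential_along \<gamma> L \<Longrightarrow> (\<And>t. t \<in> {0..1} \<Longrightarrow> \<gamma> t = \<eta> t) \<Longrightarrow> potential_along \<eta> L"
  unfolding potential_along_def by metis

lemma potential_along_const:
  assumes "p \<in> \<Omega>"
  shows "potential_along (\<lambda>_. p) (\<lambda>_. v)"
proof -
  obtain r where r: "r > 0" "ball p r \<subseteq> \<Omega>" using open_domain assms openE by blast
  obtain \<psi> where "potential_on \<psi> g (ball p r)" using potential_on_ball[OF r(2)] .
  then show ?thesis
    unfolding potential_along_def using r by (intro ballI exI[of _ p] exI[of _ r] exI[of _ \<psi>] exI[of _ 1]) auto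
qed

lemma potential_along_locally:
  assumes L: "potential_along \<gamma> L" and t: "t \<in> {0..1}" and cont: "continuous_on {0..1} \<gamma>"
    and B: "potential_on \<psi> g (ball c r)" "\<gamma> t \<in> ball c r"
  shows "\<exists>e>0. \<forall>s\<in>{0..1}. \<bar>s - t\<bar> < e \<longrightarrow> \<gamma> s \<in> ball c r \<and> L s - \<psi> (\<gamma> s) = L t - \<psi> (\<gamma> t)"
proof -
  obtain c1 r1 \<psi>1 e1 where 1: "potential_on \<psi>1 g (ball c1 r1)" "e1 > 0"
    "\<And>s. s \<in> {0..1} \<Longrightarrow> \<bar>s - t\<bar> < e1 \<Longrightarrow> \<gamma> s \<in> ball c1 r1 \<and> L s - \<psi>1 (\<gamma> s) = L t - \<psi>1 (\<gamma> t)"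
    using L t unfolding potential_along_def by blast
  have \<gamma>t: "\<gamma> t \<in> ball c1 r1" using 1(3)[of t] 1(2) t by simp
  obtain e2 where e2: "e2 > 0"
    "\<And>s. s \<in> {0..1} \<Longrightarrow> dist s t < e2 \<Longrightarrow> dist (\<gamma> s) (\<gamma> t) < r - dist c (\<gamma> t)"
    using cont t B(2) unfolding continuous_on_iff by (metis dist_commute mem_ball diff_gt_0_iff_gt)
  show ?thesis
  proof (intro exI[of _ "min e1 e2"] conjI ballI impI)
    show "0 < min e1 e2" using 1(2) e2(1) by simp
    fix s assume s: "s \<in> {0..1}" "\<bar>s - t\<bar> < min e1 e2"
    have "dist (\<gamma> s) (\<gamma> t) < r - dist c (\<gamma> t)" using e2(2)[of s] s by (simp add: dist_real_def)
    then show \<gamma>s: "\<gamma> s \<in> ball c r"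
      by (simp add: dist_commute) (metis dist_triangle add.commute le_less_trans less_diff_eq dist_commute)
    have "\<gamma> s \<in> ball c1 r1" and eq: "L s - \<psi>1 (\<gamma> s) = L t - \<psi>1 (\<gamma> t)" using 1(3)[of s] s by auto
    with potential_on_unique_balls[OF 1(1) B(1) _ \<gamma>s \<gamma>t B(2)]
    show "L s - \<psi> (\<gamma> s) = L t - \<psi> (\<gamma> t)" by (smt (verit))
  qed
qed

lemma potential_along_unique:
  assumes L1: "potential_along \<gamma> L1" and L2: "potential_along \<gamma> L2"
    and cont: "continuous_on {0..1} \<gamma>" and "L1 0 = L2 0" and t: "t \<in> {0..1}"
  shows "L1 t = L2 t"
proof -
  have "L1 0 - L2 0 = L1 t - L2 t"
  proof (rule locally_constant_on_unit_interval[of "\<lambda>s. L1 s - L2 s"])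
    fix t :: real assume t: "t \<in> {0..1}"
    obtain c r \<psi> e where 1: "potential_on \<psi> g (ball c r)" "e > 0"
      "\<And>s. s \<in> {0..1} \<Longrightarrow> \<bar>s - t\<bar> < e \<Longrightarrow> \<gamma> s \<in> ball c r \<and> L1 s - \<psi> (\<gamma> s) = L1 t - \<psi> (\<gamma> t)"
      using L1 t unfolding potential_along_def by blast
    have "\<gamma> t \<in> ball c r" using 1(3)[of t] 1(2) t by simp
    from potential_along_locally[OF L2 t cont 1(1) this] obtain e2 where e2: "e2 > 0"
      "\<And>s. s \<in> {0..1} \<Longrightarrow> \<bar>s - t\<bar> < e2 \<Longrightarrow> L2 s - \<psi> (\<gamma> s) = L2 t - \<psi> (\<gamma> t)" by blast
    show "\<exists>e>0. \<forall>s\<in>{0..1}. \<bar>s - t\<bar> < e \<longrightarrow> L1 s - L2 s = L1 t - L2 t"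
      using 1(2,3) e2 by (intro exI[of _ "min e e2"]) force
  qed (use t in auto)
  then show ?thesis using assms(4) by simp
qed

lemma potential_along_nearby:
  assumes cont: "continuous_on {0..1} \<gamma>"
    and in_\<Omega>: "\<And>t. t \<in> {0..1} \<Longrightarrow> ball (\<gamma> t) r \<subseteq> \<Omega>"
    and close: "\<And>t. t \<in> {0..1} \<Longrightarrow> dist (\<eta> t) (\<gamma> t) < r/2"
    and L: "potential_along \<gamma> L"
  obtains M where "potential_along \<eta> M"
    "\<And>t \<psi>. t \<in> {0..1} \<Longrightarrow> potential_on \<psi> g (ball (\<gamma> t) r) \<Longrightarrow> M t = L t + \<psi> (\<eta> t) - \<psi> (\<gamma> t)"
proof -
  define \<Psi> where "\<Psi> t = (SOME \<psi>. potential_on \<psi> g (ball (\<gamma> t) r))" for t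
  have \<Psi>: "potential_on (\<Psi> t) g (ball (\<gamma> t) r)" if "t \<in> {0..1}" for t
    unfolding \<Psi>_def using potential_on_ball[OF in_\<Omega>[OF that]] by (metis someI_ex)
  have in_ball: "\<eta> t \<in> ball (\<gamma> t) r" "\<gamma> t \<in> ball (\<gamma> t) r" if "t \<in> {0..1}" for t
  proof -
    have "dist (\<eta> t) (\<gamma> t) < r" "0 < r"
      using close[OF that] zero_le_dist[of "\<eta> t" "\<gamma> t"] by linarith+
    then show "\<eta> t \<in> ball (\<gamma> t) r" "\<gamma> t \<in> ball (\<gamma> t) r" by (auto simp: dist_commute)
  qed
  define M where "M t = L t + \<Psi> t (\<eta> t) - \<Psi> t (\<gamma> t)" for t
  have "potential_along \<eta> M"
    unfolding potential_along_def
  proof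
    fix t :: real assume t: "t \<in> {0..1}"
    obtain e1 where e1: "e1 > 0" "\<And>s. s \<in> {0..1} \<Longrightarrow> \<bar>s - t\<bar> < e1 \<Longrightarrow>
        \<gamma> s \<in> ball (\<gamma> t) r \<and> L s - \<Psi> t (\<gamma> s) = L t - \<Psi> t (\<gamma> t)"
      using potential_along_locally[OF L t cont \<Psi>[OF t] in_ball(2)[OF t]] by blast
    obtain e2 where e2: "e2 > 0" "\<And>s. s \<in> {0..1} \<Longrightarrow> dist s t < e2 \<Longrightarrow> dist (\<gamma> s) (\<gamma> t) < r/2"
      using cont t in_ball(2)[OF t] unfolding continuous_on_iff by (metis centre_in_ball half_gt_zero)
    show "\<exists>c r \<psi> e. ball c r \<subseteq> \<Omega> \<and> potential_on \<psi> g (ball c r) \<and> e > 0 \<and>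
      (\<forall>s\<in>{0..1}. \<bar>s - t\<bar> < e \<longrightarrow> \<eta> s \<in> ball c r \<and> M s - \<psi> (\<eta> s) = M t - \<psi> (\<eta> t))"
    proof (intro exI conjI ballI impI)
      show "ball (\<gamma> t) r \<subseteq> \<Omega>" "potential_on (\<Psi> t) g (ball (\<gamma> t) r)" "0 < min e1 e2"
        using in_\<Omega>[OF t] \<Psi>[OF t] e1 e2 by simp_all
      fix s assume s: "s \<in> {0..1}" "\<bar>s - t\<bar> < min e1 e2"
      have "dist (\<gamma> s) (\<gamma> t) < r/2" using e2(2)[of s] s by (simp add: dist_real_def)
      then show \<eta>s: "\<eta> s \<in> ball (\<gamma> t) r"
        using close[OF s(1)] dist_triangle[of "\<gamma> t" "\<eta> s" "\<gamma> s"] by (simp add: dist_commute)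
      have "L s - \<Psi> t (\<gamma> s) = L t - \<Psi> t (\<gamma> t)" and \<gamma>s: "\<gamma> s \<in> ball (\<gamma> t) r"
        using e1(2)[of s] s by auto
      with potential_on_unique_balls[OF \<Psi>[OF s(1)] \<Psi>[OF t] in_ball(1)[OF s(1)] \<eta>s in_ball(2)[OF s(1)] \<gamma>s]
      show "M s - \<Psi> t (\<eta> s) = M t - \<Psi> t (\<eta> t)"
        unfolding M_def by linarith
    qed
  qed
  moreover have "M t = L t + \<psi> (\<eta> t) - \<psi> (\<gamma> t)"
    if t: "t \<in> {0..1}" and \<psi>: "potential_on \<psi> g (ball (\<gamma> t) r)" for t \<psi>
    using potential_on_unique_balls[OF \<psi> \<Psi>[OF t] in_ball(1)[OF t] in_ball(1)[OF t] in_ball(2)[OF t] in_ball(2)[OF t]]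
    unfolding M_def by linarith
  ultimately show ?thesis using that by blast
qed


text \<open>Deforming a path through a continuous family keeps a continuation, and the continuation
  does not move at parameters where the family is stationary: subdivide the deformation so finely
  that consecutive paths are uniformly close and apply \<open>potential_along_nearby\<close> at each step.\<close>

lemma potential_along_deformation:
  fixes H :: "real \<times> real \<Rightarrow> 'a"
  assumes H: "continuous_on ({0..1} \<times> {0..1}) H" "H ` ({0..1} \<times> {0..1}) \<subseteq> \<Omega>"
    and L: "potential_along (\<lambda>t. H (0, t)) L"
  obtains M where "potential_along (\<lambda>t. H (1, t)) M"
    "\<And>t. t \<in> {0..1} \<Longrightarrow> (\<And>s. s \<in> {0..1} \<Longrightarrow> H (s, t) = H (0, t)) \<Longrightarrow> M t = L t"
proof -
  have "compact (H ` ({0..1} \<times> {0..1}))"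
    using H(1) by (intro compact_continuous_image compact_Times compact_Icc)
  then obtain r where r0: "r > 0" and "(\<Union>y\<in>H ` ({0..1} \<times> {0..1}). ball y r) \<subseteq> \<Omega>"
    using compact_subset_open_imp_ball_epsilon_subset[OF _ open_domain H(2)] by blast
  then have r: "r > 0" "\<And>s t. s \<in> {0..1} \<Longrightarrow> t \<in> {0..1} \<Longrightarrow> ball (H (s, t)) r \<subseteq> \<Omega>"
    by blast+
  have "uniformly_continuous_on ({0..1} \<times> {0..1}) H"
    by (rule compact_uniformly_continuous[OF H(1)]) (intro compact_Times compact_Icc)
  then obtain d where d: "d > 0" "\<And>x x'. x \<in> {0..1} \<times> {0..1} \<Longrightarrow> x' \<in> {0..1} \<times> {0..1} \<Longrightarrow>
      dist x' x < d \<Longrightarrow> dist (H x') (H x) < r/2"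
    using half_gt_zero[OF r(1)] unfolding uniformly_continuous_on_def by blast
  define stationary where "stationary t \<longleftrightarrow> (\<forall>s\<in>{0..1}. H (s, t) = H (0, t))" for t
  define P where "P s \<longleftrightarrow> (\<exists>M. potential_along (\<lambda>t. H (s, t)) M \<and>
      (\<forall>t\<in>{0..1}. stationary t \<longrightarrow> M t = L t))" for s
  have "P 1"
  proof (rule unit_interval_small_steps[OF d(1)])
    show "P 0" unfolding P_def using L by blast
  next
    fix s s' assume s: "s \<in> {0..1}" "s' \<in> {0..1}" "\<bar>s - s'\<bar> < d" and "P s"
    then obtain M where M: "potential_along (\<lambda>t. H (s, t)) M" "\<And>t. t \<in> {0..1} \<Longrightarrow> stationary t \<Longrightarrow> M t = L t"
      unfolding P_def by blast
    have "continuous_on {0..1} (\<lambda>t. H (s, t))"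
      by (rule continuous_on_compose2[OF H(1)]) (use s in \<open>auto intro!: continuous_intros\<close>)
    moreover have "dist (H (s', t)) (H (s, t)) < r/2" if "t \<in> {0..1}" for t
      using d(2)[of "(s, t)" "(s', t)"] s that by (simp add: dist_Pair_Pair dist_real_def abs_minus_commute)
    ultimately obtain M' where M': "potential_along (\<lambda>t. H (s', t)) M'"
      "\<And>t \<psi>. t \<in> {0..1} \<Longrightarrow> potential_on \<psi> g (ball (H (s, t)) r) \<Longrightarrow> M' t = M t + \<psi> (H (s', t)) - \<psi> (H (s, t))"
      using potential_along_nearby[of "\<lambda>t. H (s, t)" r "\<lambda>t. H (s', t)", OF _ r(2)[OF s(1)] _ M(1)] by blast
    have "M' t = L t" if t: "t \<in> {0..1}" "stationary t" for t
    proof -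
      obtain \<psi> where "potential_on \<psi> g (ball (H (s, t)) r)"
        using potential_on_ball[OF r(2)[OF s(1) t(1)]] .
      moreover have "H (s', t) = H (s, t)"
        using t(2) s(1,2) unfolding stationary_def by (metis (no_types))
      ultimately show ?thesis
        using M'(2)[of t \<psi>] M(2)[OF t] t(1) by simp
    qed
    then show "P s'" unfolding P_def using M'(1) by blast
  qed
  then obtain M where M: "potential_along (\<lambda>t. H (1, t)) M" "\<forall>t\<in>{0..1}. stationary t \<longrightarrow> M t = L t"
    unfolding P_def by blast
  show ?thesis
  proof (rule that[OF M(1)])
    fix t assume t: "t \<in> {0..1}" and "\<And>s. s \<in> {0..1} \<Longrightarrow> H (s, t) = H (0, t)"
    then have "stationary t" unfolding stationary_def by (intro ballI)
    then show "M t = L t" using M(2) t by blast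
  qed
qed

lemma potential_along_exists:
  assumes "path \<gamma>" "path_image \<gamma> \<subseteq> \<Omega>"
  obtains L where "potential_along \<gamma> L" "L 0 = v"
proof -
  define H where "H = (\<lambda>(s, t). \<gamma> (s * t))"
  have mult: "s * t \<in> {0..1}" if "s \<in> {0..1}" "t \<in> {0..1}" for s t :: real
    using that by (auto intro: mult_le_one)
  have "continuous_on ({0..1} \<times> {0..1}) H"
    unfolding H_def split_def
    by (rule continuous_on_compose2[of "{0..1}" \<gamma>])
      (use assms mult in \<open>auto simp: path_def intro!: continuous_intros\<close>)
  moreover have "H ` ({0..1} \<times> {0..1}) \<subseteq> \<Omega>"
    using assms(2) mult unfolding H_def path_image_def by auto
  moreover have "\<gamma> 0 \<in> \<Omega>"
    using assms(2) unfolding path_image_def by auto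
  then have "potential_along (\<lambda>t. H (0, t)) (\<lambda>_. v)"
    using potential_along_const[of "\<gamma> 0" v] unfolding H_def by simp
  ultimately obtain M where "potential_along (\<lambda>t. H (1, t)) M" "M 0 = v"
    by (rule potential_along_deformation) (auto simp: H_def)
  then show ?thesis
    using that potential_along_cong[of "\<lambda>t. H (1, t)" M \<gamma>] unfolding H_def by auto
qed

lemma potential_along_homotopic:
  assumes hp: "homotopic_paths \<Omega> p q" and L1: "potential_along p L1" and L2: "potential_along q L2"
    and "L1 0 = L2 0"
  shows "L1 1 = L2 1"
proof -
  obtain H :: "real \<times> real \<Rightarrow> 'a" where H: "continuous_on ({0..1} \<times> {0..1}) H" "H \<in> {0..1} \<times> {0..1} \<rightarrow> \<Omega>"
    "\<forall>t\<in>{0..1}. H (0, t) = p t" "\<forall>t\<in>{0..1}. H (1, t) = q t"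
    "\<forall>s\<in>{0..1}. H (s, 0) = p 0 \<and> H (s, 1) = p 1"
    using hp unfolding homotopic_paths pathstart_def pathfinish_def o_def by metis
  have "H ` ({0..1} \<times> {0..1}) \<subseteq> \<Omega>" using H(2) by blast
  obtain M where M: "potential_along (\<lambda>t. H (1, t)) M"
    "\<And>t. t \<in> {0..1} \<Longrightarrow> (\<And>s. s \<in> {0..1} \<Longrightarrow> H (s, t) = H (0, t)) \<Longrightarrow> M t = L1 t"
    using potential_along_deformation[OF H(1) \<open>H ` _ \<subseteq> \<Omega>\<close> potential_along_cong[OF L1]] H(3) by metis
  have "M 0 = L1 0" "M 1 = L1 1"
    using M(2)[of 0] M(2)[of 1] H(5) by auto
  moreover have "potential_along q M" using potential_along_cong[OF M(1)] H(4) by auto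
  moreover have "continuous_on {0..1} q" using homotopic_paths_imp_path[OF hp] by (simp add: path_def)
  ultimately show ?thesis using potential_along_unique[of q M L2 1] L2 assms(4) by simp
qed

lemma potential_along_shift_endpoint:
  assumes \<gamma>: "path \<gamma>" "path_image \<gamma> \<subseteq> \<Omega>" and L: "potential_along \<gamma> L"
  obtains r where "r > 0" "ball (pathfinish \<gamma>) r \<subseteq> \<Omega>"
    "\<And>\<Psi> y. potential_on \<Psi> g (ball (pathfinish \<gamma>) r) \<Longrightarrow> y \<in> ball (pathfinish \<gamma>) (r/2) \<Longrightarrow>
      \<exists>\<eta> M. path \<eta> \<and> path_image \<eta> \<subseteq> \<Omega> \<and> pathstart \<eta> = pathstart \<gamma> \<and> pathfinish \<eta> = y \<and>
        potential_along \<eta> M \<and> M 0 = L 0 \<and> M 1 = L 1 + \<Psi> y - \<Psi> (pathfinish \<gamma>)"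
proof -
  have cont: "continuous_on {0..1} \<gamma>" using \<gamma>(1) unfolding path_def by simp
  have "compact (\<gamma> ` {0..1})" using cont by (intro compact_continuous_image compact_Icc)
  then obtain r where "r > 0" "(\<Union>y\<in>\<gamma> ` {0..1}. ball y r) \<subseteq> \<Omega>"
    using compact_subset_open_imp_ball_epsilon_subset[OF _ open_domain] \<gamma>(2)
    unfolding path_image_def by blast
  then have r: "r > 0" "\<And>t. t \<in> {0..1} \<Longrightarrow> ball (\<gamma> t) r \<subseteq> \<Omega>" by blast+
  obtain \<Psi>0 where \<Psi>0: "potential_on \<Psi>0 g (ball (\<gamma> 0) r)" using potential_on_ball r(2)[of 0] by auto
  show ?thesis
  proof (rule that)
    show "r > 0" "ball (pathfinish \<gamma>) r \<subseteq> \<Omega>" using r by (auto simp: pathfinish_def)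
    fix \<Psi> y assume \<Psi>: "potential_on \<Psi> g (ball (pathfinish \<gamma>) r)"
      and y: "y \<in> ball (pathfinish \<gamma>) (r/2)"
    define \<eta> where "\<eta> t = \<gamma> t + t *\<^sub>R (y - \<gamma> 1)" for t
    have close: "dist (\<eta> t) (\<gamma> t) < r/2" if "t \<in> {0..1}" for t
    proof -
      have "dist (\<eta> t) (\<gamma> t) = t * norm (y - \<gamma> 1)" using that by (simp add: \<eta>_def dist_norm)
      also have "\<dots> \<le> norm (y - \<gamma> 1)" using that mult_left_le_one_le[of "norm (y - \<gamma> 1)" t] by simp
      also have "\<dots> < r/2" using y by (simp add: dist_norm norm_minus_commute pathfinish_def)
      finally show ?thesis .
    qed
    obtain M where M: "potential_along \<eta> M"
      "\<And>t \<psi>. t \<in> {0..1} \<Longrightarrow> potential_on \<psi> g (ball (\<gamma> t) r) \<Longrightarrow> M t = L t + \<psi> (\<eta> t) - \<psi> (\<gamma> t)"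
      using potential_along_nearby[OF cont r(2) close L] by blast
    have "\<eta> t \<in> ball (\<gamma> t) r" if "t \<in> {0..1}" for t
      using close[OF that] r(1) by (simp add: dist_commute)
    then have "path_image \<eta> \<subseteq> \<Omega>"
      using r(2) unfolding path_image_def by blast
    moreover have "path \<eta>" using cont unfolding path_def \<eta>_def by (intro continuous_intros)
    moreover have "M 0 = L 0" "M 1 = L 1 + \<Psi> y - \<Psi> (pathfinish \<gamma>)"
      using M(2)[of 0 \<Psi>0] \<Psi>0 M(2)[of 1 \<Psi>] \<Psi> by (simp_all add: \<eta>_def pathfinish_def)
    ultimately show "\<exists>\<eta> M. path \<eta> \<and> path_image \<eta> \<subseteq> \<Omega> \<and> pathstart \<eta> = pathstart \<gamma> \<and> pathfinish \<eta> = y \<and>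
        potential_along \<eta> M \<and> M 0 = L 0 \<and> M 1 = L 1 + \<Psi> y - \<Psi> (pathfinish \<gamma>)"
      using M(1) by (intro exI[of _ \<eta>] exI[of _ M]) (simp add: \<eta>_def pathstart_def pathfinish_def)
  qed
qed

text \<open>On a simply connected domain, the end value of a continuation along any path from a base
  point depends only on the end point, and defines a global potential.\<close>

theorem global_potential:
  assumes "simply_connected \<Omega>"
  obtains \<psi> where "potential_on \<psi> g \<Omega>"
proof (cases "\<Omega> = {}")
  case True then show ?thesis using that by (auto simp: potential_on_def)
next
  case False
  then obtain z0 where z0: "z0 \<in> \<Omega>" by blast
  have pc: "path_connected \<Omega>" and hom: "\<And>p q. path p \<Longrightarrow> path_image p \<subseteq> \<Omega> \<Longrightarrow> path q \<Longrightarrow>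
      path_image q \<subseteq> \<Omega> \<Longrightarrow> pathstart q = pathstart p \<Longrightarrow> pathfinish q = pathfinish p \<Longrightarrow>
      homotopic_paths \<Omega> p q"
    using assms unfolding simply_connected_eq_homotopic_paths by blast+
  define reaches where "reaches x v \<longleftrightarrow> (\<exists>\<gamma> L. path \<gamma> \<and> path_image \<gamma> \<subseteq> \<Omega> \<and> pathstart \<gamma> = z0 \<and>
      pathfinish \<gamma> = x \<and> potential_along \<gamma> L \<and> L 0 = 0 \<and> L 1 = v)" for x v
  define V where "V x = (THE v. reaches x v)" for x
  have V: "V x = L 1" if "path \<gamma>" "path_image \<gamma> \<subseteq> \<Omega>" "pathstart \<gamma> = z0" "pathfinish \<gamma> = x"
    "potential_along \<gamma> L" "L 0 = 0" for \<gamma> L x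
    unfolding V_def
  proof (rule the_equality)
    show "reaches x (L 1)" unfolding reaches_def using that by blast
    fix v assume "reaches x v"
    then obtain \<gamma>' L' where \<gamma>': "path \<gamma>'" "path_image \<gamma>' \<subseteq> \<Omega>" "pathstart \<gamma>' = z0"
      "pathfinish \<gamma>' = x" "potential_along \<gamma>' L'" "L' 0 = 0" "L' 1 = v"
      unfolding reaches_def by blast
    have "homotopic_paths \<Omega> \<gamma> \<gamma>'" using hom[of \<gamma> \<gamma>'] that \<gamma>' by simp
    from potential_along_homotopic[OF this that(5) \<gamma>'(5)] that(6) \<gamma>'(6,7) show "v = L 1" by simp
  qed
  have "(V has_derivative (\<lambda>h. g x \<bullet> h)) (at x)" if x: "x \<in> \<Omega>" for x
  proof -
    obtain \<gamma> where \<gamma>: "path \<gamma>" "path_image \<gamma> \<subseteq> \<Omega>" "pathstart \<gamma> = z0" "pathfinish \<gamma> = x"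
      using pc z0 x unfolding path_connected_def by blast
    obtain L where L: "potential_along \<gamma> L" "L 0 = 0" using potential_along_exists[OF \<gamma>(1,2)] .
    obtain r where r: "r > 0" "ball x r \<subseteq> \<Omega>" and shift: "\<And>\<Psi> y. potential_on \<Psi> g (ball x r) \<Longrightarrow>
        y \<in> ball x (r/2) \<Longrightarrow> \<exists>\<eta> M. path \<eta> \<and> path_image \<eta> \<subseteq> \<Omega> \<and> pathstart \<eta> = z0 \<and> pathfinish \<eta> = y \<and>
          potential_along \<eta> M \<and> M 0 = L 0 \<and> M 1 = L 1 + \<Psi> y - \<Psi> x"
      using potential_along_shift_endpoint[OF \<gamma>(1,2) L(1)] unfolding \<gamma>(3,4) by blast
    obtain \<Psi> where \<Psi>: "potential_on \<Psi> g (ball x r)" using potential_on_ball[OF r(2)] .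
    have "((\<lambda>y. V x + \<Psi> y - \<Psi> x) has_derivative (\<lambda>h. g x \<bullet> h)) (at x)"
      using \<Psi> r(1) unfolding potential_on_def by (auto intro!: derivative_eq_intros)
    then show ?thesis
    proof (rule has_derivative_transform_within_open[where s="ball x (r/2)"])
      show "x \<in> ball x (r/2)" using r(1) by simp
      fix y assume "y \<in> ball x (r/2)"
      then obtain \<eta> M where "path \<eta>" "path_image \<eta> \<subseteq> \<Omega>" "pathstart \<eta> = z0" "pathfinish \<eta> = y"
        "potential_along \<eta> M" "M 0 = L 0" and M1: "M 1 = L 1 + \<Psi> y - \<Psi> x"
        using shift[OF \<Psi>] by blast
      then have "V y = M 1" using V L(2) by simp
      then show "V x + \<Psi> y - \<Psi> x = V y" using M1 V[OF \<gamma> L] by simp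
    qed simp
  qed
  then show ?thesis using that unfolding potential_on_def by blast
qed

end

section \<open>The Clifford algebra\<close>

definition blade :: "('n::finite) set \<Rightarrow> 'n mvec" where
  "blade A = (\<chi> C. if C = A then 1 else 0)"

lemma blade_nth: "blade A $ C = (if C = A then 1 else 0)"
  by (simp add: blade_def)

lemma cgen_eq_blade: "cgen j = blade {j}"
  by (simp add: cgen_def blade_def)

lemma csc_eq_blade: "csc r = r *\<^sub>R blade {}"
  by (simp add: csc_def blade_def vec_eq_iff)

lemma cvec_eq_sum_blade: "cvec a = (\<Sum>j\<in>UNIV. (a $ j) *\<^sub>R blade {j})"
  by (simp add: cvec_def cgen_eq_blade)

lemma cmult_nth: "cmult x y $ C = (\<Sum>A\<in>UNIV. \<Sum>B\<in>UNIV.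
       (if (A - B) \<union> (B - A) = C then csign A B * (x $ A) * (y $ B) else 0))"
  by (simp add: cmult_def)

lemma cmult_add_left: "cmult (x + y) z = cmult x z + cmult y z"
  by (simp add: vec_eq_iff cmult_nth algebra_simps sum.distrib[symmetric] if_distrib cong: if_cong)

lemma cmult_add_right: "cmult z (x + y) = cmult z x + cmult z y"
  by (simp add: vec_eq_iff cmult_nth algebra_simps sum.distrib[symmetric] if_distrib cong: if_cong)

lemma cmult_scaleR_left: "cmult (r *\<^sub>R x) z = r *\<^sub>R cmult x z"
  by (simp add: vec_eq_iff cmult_nth sum_distrib_left if_distrib algebra_simps cong: if_cong)

lemma cmult_scaleR_right: "cmult z (r *\<^sub>R x) = r *\<^sub>R cmult z x"
  by (simp add: vec_eq_iff cmult_nth sum_distrib_left if_distrib algebra_simps cong: if_cong)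

lemma cmult_sum_left: "cmult (\<Sum>i\<in>I. f i) z = (\<Sum>i\<in>I. cmult (f i) z)"
  by (induction I rule: infinite_finite_induct)
    (simp_all add: cmult_add_left cmult_scaleR_left[of 0, simplified])

lemma cmult_sum_right: "cmult z (\<Sum>i\<in>I. f i) = (\<Sum>i\<in>I. cmult z (f i))"
  by (induction I rule: infinite_finite_induct)
    (simp_all add: cmult_add_right cmult_scaleR_right[of _ 0, simplified])

lemma cmult_blade: "cmult (blade A) (blade B) = csign A B *\<^sub>R blade ((A - B) \<union> (B - A))"
proof (unfold vec_eq_iff, intro allI)
  fix C
  have "(if (A' - B') \<union> (B' - A') = C then csign A' B' * (blade A $ A') * (blade B $ B') else 0) =
     (if A' = A then (if B' = B then (if (A - B) \<union> (B - A) = C then csign A B else 0) else 0) else 0)"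
    for A' B' by (auto simp: blade_nth)
  then have "cmult (blade A) (blade B) $ C = (\<Sum>A'\<in>UNIV. \<Sum>B'\<in>UNIV.
      (if A' = A then (if B' = B then (if (A - B) \<union> (B - A) = C then csign A B else 0) else 0) else 0))"
    unfolding cmult_nth by presburger
  also have "\<dots> = (\<Sum>A'\<in>UNIV. (if A' = A then (if (A - B) \<union> (B - A) = C then csign A B else 0) else 0))"
    by (intro sum.cong refl) simp
  also have "\<dots> = (if (A - B) \<union> (B - A) = C then csign A B else 0)"
    by simp
  finally show "cmult (blade A) (blade B) $ C = (csign A B *\<^sub>R blade ((A - B) \<union> (B - A))) $ C"
    by (simp add: blade_nth)
qed

lemma csign_singleton_empty: "csign {j} {} = 1"
  by (simp add: csign_def)

lemma csign_singletons:
  fixes j k :: "'n::{finite,linorder}"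
  shows "csign {j} {k} = (if j = k then -1 else if k < j then -1 else 1)"
proof -
  have "{(a, b). a \<in> {j} \<and> b \<in> {k} \<and> b < a} = (if k < j then {(j,k)} else {})" by auto
  moreover have "{j} \<inter> {k} = (if j = k then {j} else {})" by auto
  ultimately show ?thesis unfolding csign_def by auto
qed

lemma cmult_blade_anticommute:
  fixes j k :: "'n::{finite,linorder}"
  shows "cmult (blade {j}) (blade {k}) + cmult (blade {k}) (blade {j}) =
    (if j = k then -2 else 0) *\<^sub>R blade {}"
proof (cases "j = k")
  case True
  then show ?thesis
    using scaleR_left_distrib[of "-1" "-1" "blade {} :: 'n mvec"] by (simp add: cmult_blade csign_singletons)
next
  case False
  then have "k < j \<or> j < k" by auto
  then show ?thesis
    using False by (auto simp: cmult_blade csign_singletons insert_commute)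
qed

lemma cmult_cvec_anticommute:
  fixes a b :: "('n::{finite,linorder}) rvec"
  shows "cmult (cvec a) (cvec b) + cmult (cvec b) (cvec a) = csc (- 2 * (a \<bullet> b))"
proof -
  have expand: "cmult (cvec x) (cvec y) =
      (\<Sum>j\<in>UNIV. \<Sum>k\<in>UNIV. (x $ j * y $ k) *\<^sub>R cmult (blade {j}) (blade {k}))" for x y :: "'n rvec"
    unfolding cvec_eq_sum_blade[of x] cmult_sum_left cmult_scaleR_left
    unfolding cvec_eq_sum_blade[of y] cmult_sum_right cmult_scaleR_right scaleR_sum_right scaleR_scaleR ..
  have "cmult (cvec a) (cvec b) + cmult (cvec b) (cvec a) =
      (\<Sum>j\<in>UNIV. \<Sum>k\<in>UNIV. (a $ j * b $ k) *\<^sub>R cmult (blade {j}) (blade {k})) +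
      (\<Sum>j\<in>UNIV. \<Sum>k\<in>UNIV. (a $ j * b $ k) *\<^sub>R cmult (blade {k}) (blade {j}))"
    unfolding expand by (subst (2) sum.swap) (simp add: mult.commute)
  also have "\<dots> = (\<Sum>j\<in>UNIV. \<Sum>k\<in>UNIV. (a $ j * b $ k) *\<^sub>R
        (cmult (blade {j}) (blade {k}) + cmult (blade {k}) (blade {j})))"
    by (simp add: sum.distrib[symmetric] scaleR_add_right)
  also have "\<dots> = (\<Sum>j\<in>UNIV. \<Sum>k\<in>UNIV. if k = j then (-2 * (a $ j * b $ j)) *\<^sub>R blade {} else 0)"
    unfolding cmult_blade_anticommute by (intro sum.cong refl) auto
  also have "\<dots> = (\<Sum>j\<in>UNIV. (-2 * (a $ j * b $ j)) *\<^sub>R blade {})"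
    by simp
  also have "\<dots> = (\<Sum>j\<in>UNIV. -2 * (a $ j * b $ j)) *\<^sub>R blade {}"
    by (simp only: scaleR_sum_left)
  also have "\<dots> = csc (- 2 * (a \<bullet> b))"
    by (simp add: csc_eq_blade inner_vec_def sum_distrib_left)
  finally show ?thesis .
qed

lemma cmult_cvec_self:
  fixes a :: "('n::{finite,linorder}) rvec"
  shows "cmult (cvec a) (cvec a) = csc (- (a \<bullet> a))"
proof -
  have "2 *\<^sub>R cmult (cvec a) (cvec a) = 2 *\<^sub>R csc (- (a \<bullet> a))"
    using cmult_cvec_anticommute[of a a] by (simp add: csc_eq_blade scaleR_2)
  then show ?thesis by simp
qed

lemma cmult_cgen_csc: "cmult (cgen j) (csc r) = r *\<^sub>R cgen j"
  by (simp add: cgen_eq_blade csc_eq_blade cmult_scaleR_right cmult_blade csign_singleton_empty)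

lemma cmult_cvec_left: "cmult (cvec a) X = (\<Sum>j\<in>UNIV. (a $ j) *\<^sub>R cmult (cgen j) X)"
  unfolding cvec_def cmult_sum_left cmult_scaleR_left ..

lemma cmult_blade_singletons_nth:
  fixes i l j k :: "'n::{finite,linorder}"
  assumes "j < k"
  shows "cmult (blade {i}) (blade {l}) $ {j, k} =
    (if i = j \<and> l = k then 1 else if i = k \<and> l = j then -1 else 0)"
proof -
  have jk: "j \<noteq> k" "\<not> k < j" using assms by auto
  show ?thesis
  proof (cases "i = l")
    case True
    then show ?thesis using jk by (simp add: cmult_blade blade_nth)
  next
    case False
    then have "({i} - {l}) \<union> ({l} - {i}) = {i, l}" by auto
    then have "cmult (blade {i}) (blade {l}) $ {j, k} = csign {i} {l} * (if {j, k} = {i, l} then 1 else 0)"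
      by (simp add: cmult_blade blade_nth)
    moreover have "{j, k} = {i, l} \<longleftrightarrow> (i = j \<and> l = k) \<or> (i = k \<and> l = j)"
      by (auto simp: doubleton_eq_iff)
    ultimately show ?thesis
      using jk assms by (auto simp: csign_singletons)
  qed
qed

lemma dirac_sum_bivector_nth:
  fixes j k :: "'n::{finite,linorder}"
  assumes "j < k"
  shows "(\<Sum>i\<in>UNIV. cmult (cgen i) (cvec (D i))) $ {j, k} = D j $ k - D k $ j"
proof -
  have "(\<Sum>i\<in>UNIV. cmult (cgen i) (cvec (D i))) $ {j, k} =
      (\<Sum>i\<in>UNIV. \<Sum>l\<in>UNIV. D i $ l * (if i = j \<and> l = k then 1 else if i = k \<and> l = j then -1 else 0))"
    by (simp only: cgen_eq_blade cvec_eq_sum_blade cmult_sum_right cmult_scaleR_right sum_component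
        vector_scaleR_component cmult_blade_singletons_nth[OF assms] real_scaleR_def)
  also have "\<dots> = (\<Sum>i\<in>UNIV. \<Sum>l\<in>UNIV. (if l = k then if i = j then D j $ k else 0 else 0) +
      (if l = j then if i = k then - D k $ j else 0 else 0))"
    using assms by (intro sum.cong refl) auto
  also have "\<dots> = D j $ k - D k $ j"
    by (simp add: sum.distrib)
  finally show ?thesis .
qed

lemma cvec_nth_singleton: "cvec a $ {j} = a $ j"
proof -
  have "cvec a $ {j} = (\<Sum>i\<in>UNIV. a $ i * (if {j} = {i} then 1 else 0))"
    by (simp add: cvec_eq_sum_blade blade_nth)
  also have "\<dots> = (\<Sum>i\<in>UNIV. if i = j then a $ i else 0)"
    by (intro sum.cong) auto
  finally show ?thesis by simp
qed

lemma cinner_cvec: "cinner (cvec a) (cvec b) = a \<bullet> b"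
  by (simp add: cinner_def cvec_nth_singleton inner_vec_def)

lemma cvec_add: "cvec (a + b) = cvec a + cvec b"
  by (simp add: cvec_def scaleR_add_left sum.distrib)

lemma cvec_scaleR: "cvec (r *\<^sub>R a) = r *\<^sub>R cvec a"
  by (simp add: cvec_def scaleR_sum_right)

lemma cvec_inject: "cvec a = cvec b \<longleftrightarrow> a = b"
  by (metis cvec_nth_singleton vec_eq_iff)

lemma bounded_linear_cvec: "bounded_linear cvec"
  by (simp add: linear_conv_bounded_linear[symmetric] linear_iff cvec_add cvec_scaleR)

lemma csc_add: "csc a + csc b = csc (a + b)"
  by (simp add: csc_eq_blade scaleR_add_left)

lemma csc_uminus: "- csc a = csc (- a)"
  by (simp add: csc_eq_blade)

lemma csc_scaleR: "r *\<^sub>R csc a = csc (r * a)"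
  by (simp add: csc_eq_blade)

lemma bounded_linear_csc: "bounded_linear csc"
  by (simp add: linear_conv_bounded_linear[symmetric] linear_iff csc_eq_blade scaleR_add_left)

section \<open>Partial derivatives and the Dirac operator\<close>

lemma has_partial_imp_has_vector_derivative:
  "has_partial F j x \<Longrightarrow> ((\<lambda>t. F (x + t *\<^sub>R axis j 1)) has_vector_derivative cpartial F j x) (at 0)"
  unfolding has_partial_def cpartial_def by (rule vector_derivative_works[THEN iffD1])

lemma partial_if_has_vector_derivative:
  assumes "((\<lambda>t. F (x + t *\<^sub>R axis j 1)) has_vector_derivative D) (at 0)"
  shows "has_partial F j x" "cpartial F j x = D"
  using assms unfolding has_partial_def cpartial_def
  by (auto intro: differentiableI_vector vector_derivative_at)

lemma partial_if_has_derivative: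
  assumes "(F has_derivative F') (at x)"
  shows "has_partial F j x" "cpartial F j x = F' (axis j 1)"
proof -
  have "((F \<circ> (\<lambda>t. x + t *\<^sub>R axis j 1)) has_derivative (F' \<circ> (\<lambda>s. s *\<^sub>R axis j 1))) (at 0)"
    by (rule diff_chain_at) (use assms in \<open>auto intro!: derivative_eq_intros\<close>)
  then have "((\<lambda>t. F (x + t *\<^sub>R axis j 1)) has_vector_derivative F' (axis j 1)) (at 0)"
    unfolding has_vector_derivative_def
    using linear_scale[OF has_derivative_linear[OF assms]] by (simp add: o_def)
  then show "has_partial F j x" "cpartial F j x = F' (axis j 1)"
    by (rule partial_if_has_vector_derivative)+
qed

lemma partial_bounded_linear:
  assumes "bounded_linear T" and "has_partial F j x"
  shows "has_partial (\<lambda>y. T (F y)) j x" "cpartial (\<lambda>y. T (F y)) j x = T (cpartial F j x)"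
  using partial_if_has_vector_derivative[OF bounded_linear.has_vector_derivative[OF assms(1)
        has_partial_imp_has_vector_derivative[OF assms(2)]]] by auto

lemma partial_add:
  assumes "has_partial F j x" "has_partial G j x"
  shows "has_partial (\<lambda>y. F y + G y) j x" "cpartial (\<lambda>y. F y + G y) j x = cpartial F j x + cpartial G j x"
  using partial_if_has_vector_derivative[OF has_vector_derivative_add[OF
        has_partial_imp_has_vector_derivative[OF assms(1)] has_partial_imp_has_vector_derivative[OF assms(2)]]]
  by auto

lemma partial_cong:
  assumes "open U" "x \<in> U" and eq: "\<And>y. y \<in> U \<Longrightarrow> F y = G y"
  shows "has_partial F j x = has_partial G j x" "cpartial F j x = cpartial G j x"
proof -
  obtain r where r: "r > 0" "ball x r \<subseteq> U" using assms(1,2) openE by blast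
  have "F (x + t *\<^sub>R axis j 1) = G (x + t *\<^sub>R axis j 1)" if "t \<in> ball 0 r" for t
    using that r by (intro eq) (auto simp: dist_norm subset_iff)
  then have iff: "((\<lambda>t. F (x + t *\<^sub>R axis j 1)) has_vector_derivative D) (at 0) \<longleftrightarrow>
      ((\<lambda>t. G (x + t *\<^sub>R axis j 1)) has_vector_derivative D) (at 0)" for D
    using r(1) by (metis (no_types, lifting) centre_in_ball has_vector_derivative_transform_within_open open_ball)
  show "has_partial F j x = has_partial G j x"
    unfolding has_partial_def vector_derivative_works[symmetric]
    by (metis iff differentiableI_vector vector_derivative_works)
  show "cpartial F j x = cpartial G j x"
    unfolding cpartial_def vector_derivative_def using iff by simp
qed

lemma dirac_cvec_if_has_derivative:
  assumes "(g has_derivative G') (at x)"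
  shows "has_partial (\<lambda>y. cvec (g y)) j x"
    "dirac (\<lambda>y. cvec (g y)) x = (\<Sum>j\<in>UNIV. cmult (cgen j) (cvec (G' (axis j 1))))"
  using partial_if_has_derivative[OF bounded_linear.has_derivative[OF bounded_linear_cvec assms]]
  by (simp_all add: dirac_def)

lemma dirac_cscf_if_has_derivative:
  assumes "(\<phi> has_derivative (\<lambda>h. d \<bullet> h)) (at x)"
  shows "has_partial (cscf \<phi>) j x" "dirac (cscf \<phi>) x = cvec d"
proof -
  have "(cscf \<phi> has_derivative (\<lambda>h. csc (d \<bullet> h))) (at x)"
    unfolding cscf_def[abs_def] by (rule bounded_linear.has_derivative[OF bounded_linear_csc assms])
  from partial_if_has_derivative[OF this]
  show "has_partial (cscf \<phi>) j x" "dirac (cscf \<phi>) x = cvec d"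
    by (simp_all add: dirac_def inner_axis cmult_cgen_csc cvec_def)
qed

lemma partial_cscf:
  assumes "has_partial (cscf \<phi>) j x"
  shows "has_partial \<phi> j x" "cpartial (cscf \<phi>) j x = csc (cpartial \<phi> j x)"
proof -
  have part: "has_partial (\<lambda>y. cscf \<phi> y $ A) j x"
    "cpartial (cscf \<phi>) j x $ A = cpartial (\<lambda>y. cscf \<phi> y $ A) j x" for A
    using partial_bounded_linear[OF bounded_linear_vec_nth assms] by auto
  have scalar: "(\<lambda>y. cscf \<phi> y $ {}) = \<phi>" by (simp add: cscf_def csc_def)
  then show "has_partial \<phi> j x" using part(1)[of "{}"] by simp
  have "(\<lambda>y. cscf \<phi> y $ A) = (\<lambda>y. 0)" if "A \<noteq> {}" for A
    using that by (simp add: cscf_def csc_def)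
  moreover have "cpartial (\<lambda>y. 0::real) j x = 0"
    by (rule partial_if_has_vector_derivative(2)) (rule has_vector_derivative_const)
  ultimately show "cpartial (cscf \<phi>) j x = csc (cpartial \<phi> j x)"
    using part(2) scalar by (auto simp: vec_eq_iff csc_def)
qed

lemma dirac_cscf:
  assumes "\<And>j. has_partial (cscf \<phi>) j x"
  shows "dirac (cscf \<phi>) x = cvec (\<chi> j. cpartial \<phi> j x)"
  by (simp add: dirac_def partial_cscf(2)[OF assms] cmult_cgen_csc cvec_def)

section \<open>The Riccati equation\<close>

lemma cmult_cvec_add_self:
  fixes a b :: "('n::{finite,linorder}) rvec"
  shows "cmult (cvec (a + b)) (cvec (a + b)) = cmult (cvec b) (cvec b) - csc (a \<bullet> a + 2 * (a \<bullet> b))"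
proof -
  have "cmult (cvec (a + b)) (cvec (a + b)) =
      cmult (cvec a) (cvec a) + (cmult (cvec a) (cvec b) + cmult (cvec b) (cvec a)) + cmult (cvec b) (cvec b)"
    by (simp add: cvec_add cmult_add_left cmult_add_right algebra_simps)
  also have "\<dots> = csc (- (a \<bullet> a)) + csc (- 2 * (a \<bullet> b)) + cmult (cvec b) (cvec b)"
    by (simp only: cmult_cvec_self cmult_cvec_anticommute)
  also have "\<dots> = cmult (cvec b) (cvec b) - csc (a \<bullet> a + 2 * (a \<bullet> b))"
    by (simp add: csc_add csc_uminus[symmetric] algebra_simps)
  finally show ?thesis .
qed

lemma riccati_shift_at:
  fixes g h :: "('n::{finite,linorder}) rvec \<Rightarrow> 'n rvec"
  assumes hp: "\<And>j. has_partial (\<lambda>y. cvec (h y)) j x"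
    and hr: "dirac (\<lambda>y. cvec (h y)) x + cmult (cvec (h x)) (cvec (h x)) = csc (v x)"
    and gd: "(g has_derivative G') (at x)"
  shows "(\<forall>j. has_partial (\<lambda>y. cvec (g y + h y)) j x) \<and>
      dirac (\<lambda>y. cvec (g y + h y)) x + cmult (cvec (g x + h x)) (cvec (g x + h x)) = csc (v x) \<longleftrightarrow>
    dirac (\<lambda>y. cvec (g y)) x = csc (g x \<bullet> g x + 2 * (g x \<bullet> h x))"
proof -
  have gp: "has_partial (\<lambda>y. cvec (g y)) j x" for j by (rule dirac_cvec_if_has_derivative(1)[OF gd])
  have split: "(\<lambda>y. cvec (g y + h y)) = (\<lambda>y. cvec (g y) + cvec (h y))" by (simp add: cvec_add)
  have "dirac (\<lambda>y. cvec (g y + h y)) x = dirac (\<lambda>y. cvec (g y)) x + dirac (\<lambda>y. cvec (h y)) x"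
    unfolding split dirac_def partial_add(2)[OF gp hp] cmult_add_right sum.distrib ..
  then have "dirac (\<lambda>y. cvec (g y + h y)) x + cmult (cvec (g x + h x)) (cvec (g x + h x)) =
      dirac (\<lambda>y. cvec (g y)) x - csc (g x \<bullet> g x + 2 * (g x \<bullet> h x)) + csc (v x)"
    using hr unfolding cmult_cvec_add_self by (simp add: algebra_simps)
  then show ?thesis
    using partial_add(1)[OF gp hp] unfolding split by simp
qed

lemma has_derivative_frechet_derivative_on_open:
  "open S \<Longrightarrow> g differentiable_on S \<Longrightarrow> x \<in> S \<Longrightarrow> (g has_derivative frechet_derivative g (at x)) (at x)"
  by (simp add: differentiable_on_eq_differentiable_at frechet_derivative_works[symmetric])

lemma riccati_solution_shift_iff:
  assumes "open \<Omega>" and h: "riccati_solution \<Omega> v h" and "g differentiable_on \<Omega>"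
  shows "riccati_solution \<Omega> v (\<lambda>x. g x + h x) \<longleftrightarrow>
    (\<forall>x\<in>\<Omega>. dirac (\<lambda>y. cvec (g y)) x = csc (g x \<bullet> g x + 2 * (g x \<bullet> h x)))"
proof -
  have "(\<forall>j. has_partial (\<lambda>y. cvec (g y + h y)) j x) \<and>
      dirac (\<lambda>y. cvec (g y + h y)) x + cmult (cvec (g x + h x)) (cvec (g x + h x)) = csc (v x) \<longleftrightarrow>
    dirac (\<lambda>y. cvec (g y)) x = csc (g x \<bullet> g x + 2 * (g x \<bullet> h x))" if x: "x \<in> \<Omega>" for x
    by (rule riccati_shift_at[OF _ _ has_derivative_frechet_derivative_on_open[OF assms(1,3) x]])
      (use h x in \<open>auto simp: riccati_solution_def\<close>)
  then show ?thesis unfolding riccati_solution_def by blast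
qed

text \<open>A vanishing bivector part of \<open>\<partial>g\<close> says \<open>\<partial>\<^sub>jg\<^sub>k = \<partial>\<^sub>kg\<^sub>j\<close>.\<close>

lemma symmetric_derivative_if_dirac_scalar:
  fixes g :: "('n::{finite,linorder}) rvec \<Rightarrow> 'n rvec"
  assumes D: "(g has_derivative D) (at x)" and scalar: "dirac (\<lambda>y. cvec (g y)) x = csc r"
  shows "D u \<bullet> w = D w \<bullet> u"
proof -
  have lin: "linear D" using D by (rule has_derivative_linear)
  have "D (axis j 1) $ k = D (axis k 1) $ j" if "j < k" for j k
    using dirac_sum_bivector_nth[OF that, of "\<lambda>i. D (axis i 1)"] that
      scalar[unfolded dirac_cvec_if_has_derivative(2)[OF D]] by (simp add: csc_def)
  then have sym: "D (axis j 1) $ k = D (axis k 1) $ j" for j k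
    by (cases j k rule: linorder_cases) auto
  have expand: "D a \<bullet> b = (\<Sum>j\<in>UNIV. \<Sum>k\<in>UNIV. a $ j * b $ k * D (axis j 1) $ k)" for a b
  proof -
    have "a = (\<Sum>j\<in>UNIV. a $ j *\<^sub>R axis j 1)"
      by (simp add: vec_eq_iff axis_def if_distrib sum.delta cong: if_cong)
    then have "D a = D (\<Sum>j\<in>UNIV. a $ j *\<^sub>R axis j 1)"
      by (rule arg_cong)
    also have "\<dots> = (\<Sum>j\<in>UNIV. a $ j *\<^sub>R D (axis j 1))"
      by (simp add: linear_sum[OF lin] linear_scale[OF lin])
    finally have "D a = (\<Sum>j\<in>UNIV. a $ j *\<^sub>R D (axis j 1))" .
    then have "D a \<bullet> b = (\<Sum>k\<in>UNIV. (\<Sum>j\<in>UNIV. a $ j * D (axis j 1) $ k) * b $ k)"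
      by (simp add: inner_vec_def)
    also have "\<dots> = (\<Sum>k\<in>UNIV. \<Sum>j\<in>UNIV. a $ j * b $ k * D (axis j 1) $ k)"
      by (simp add: sum_distrib_right sum_distrib_left algebra_simps)
    also have "\<dots> = (\<Sum>j\<in>UNIV. \<Sum>k\<in>UNIV. a $ j * b $ k * D (axis j 1) $ k)"
      by (rule sum.swap)
    finally show ?thesis .
  qed
  have "(\<Sum>j\<in>UNIV. \<Sum>k\<in>UNIV. u $ j * w $ k * D (axis j 1) $ k) =
      (\<Sum>j\<in>UNIV. \<Sum>k\<in>UNIV. u $ j * w $ k * D (axis k 1) $ j)"
    using sym by presburger
  also have "\<dots> = (\<Sum>k\<in>UNIV. \<Sum>j\<in>UNIV. w $ k * u $ j * D (axis k 1) $ j)"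
    by (subst sum.swap) (simp add: mult.commute)
  finally show ?thesis
    unfolding expand .
qed

lemma curl_free_on_if_dirac_scalar:
  fixes g :: "('n::{finite,linorder}) rvec \<Rightarrow> 'n rvec"
  assumes "open \<Omega>" "g differentiable_on \<Omega>" "\<And>x. x \<in> \<Omega> \<Longrightarrow> dirac (\<lambda>y. cvec (g y)) x = csc (r x)"
  shows "curl_free_on g \<Omega>"
  unfolding curl_free_on_def
  using has_derivative_frechet_derivative_on_open[OF assms(1,2)]
    symmetric_derivative_if_dirac_scalar[OF _ assms(3)] by blast

text \<open>The logarithmic derivative \<open>g = \<partial>\<phi>/\<phi>\<close> satisfies \<open>\<partial>g = \<partial>\<^sup>2\<phi>/\<phi> + |g|\<^sup>2\<close>:
  the quotient rule gives \<open>\<partial>g = \<partial>\<^sup>2\<phi>/\<phi> - (\<partial>\<phi>)\<^sup>2/\<phi>\<^sup>2\<close>, and \<open>(\<partial>\<phi>)\<^sup>2 = -|\<partial>\<phi>|\<^sup>2\<close>.\<close>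

lemma dirac_log_derivative:
  fixes \<phi> :: "('n::{finite,linorder}) rvec \<Rightarrow> real" and g :: "'n rvec \<Rightarrow> 'n rvec"
  assumes S: "open S" "x \<in> S" and nz: "\<phi> x \<noteq> 0"
    and p: "\<And>j. has_partial (cscf \<phi>) j x" and pp: "\<And>j. has_partial (dirac (cscf \<phi>)) j x"
    and g: "\<And>y. y \<in> S \<Longrightarrow> cvec (g y) = (1 / \<phi> y) *\<^sub>R dirac (cscf \<phi>) y"
  shows "dirac (\<lambda>y. cvec (g y)) x = (1 / \<phi> x) *\<^sub>R dirac (dirac (cscf \<phi>)) x + csc (g x \<bullet> g x)"
proof -
  define U where "U = dirac (cscf \<phi>)"
  define d where "d = (\<chi> j. cpartial \<phi> j x)"
  have Ux: "U x = cvec d" unfolding U_def d_def by (rule dirac_cscf[OF p])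
  have gx: "g x = (1 / \<phi> x) *\<^sub>R d"
    using g[OF S(2)] unfolding U_def[symmetric] Ux cvec_scaleR[symmetric] cvec_inject .
  have dg: "cpartial (\<lambda>y. cvec (g y)) j x = (1 / \<phi> x) *\<^sub>R cpartial U j x + (- d $ j / (\<phi> x)^2) *\<^sub>R U x" for j
  proof -
    have "cpartial (\<lambda>y. cvec (g y)) j x = cpartial (\<lambda>y. (1 / \<phi> y) *\<^sub>R U y) j x"
      using partial_cong(2)[OF S, of "\<lambda>y. cvec (g y)" "\<lambda>y. (1 / \<phi> y) *\<^sub>R U y"] g unfolding U_def by auto
    also have "\<dots> = (1 / \<phi> x) *\<^sub>R cpartial U j x + (- d $ j / (\<phi> x)^2) *\<^sub>R U x"
    proof (rule partial_if_has_vector_derivative(2))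
      have "((\<lambda>t. \<phi> (x + t *\<^sub>R axis j 1)) has_real_derivative d $ j) (at 0)"
        using has_partial_imp_has_vector_derivative[OF partial_cscf(1)[OF p]]
        by (simp add: d_def has_real_derivative_iff_has_vector_derivative)
      from DERIV_inverse_fun[OF this]
      have inv: "((\<lambda>t. 1 / \<phi> (x + t *\<^sub>R axis j 1)) has_real_derivative - d $ j / (\<phi> x)^2) (at 0)"
        using nz by (simp add: divide_inverse power2_eq_square)
      have "((\<lambda>t. U (x + t *\<^sub>R axis j 1)) has_vector_derivative cpartial U j x) (at 0)"
        unfolding U_def by (rule has_partial_imp_has_vector_derivative[OF pp])
      from has_vector_derivative_scaleR[OF inv this]
      show "((\<lambda>t. (1 / \<phi> (x + t *\<^sub>R axis j 1)) *\<^sub>R U (x + t *\<^sub>R axis j 1)) has_vector_derivative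
          (1 / \<phi> x) *\<^sub>R cpartial U j x + (- d $ j / (\<phi> x)^2) *\<^sub>R U x) (at 0)"
        by simp
    qed
    finally show ?thesis .
  qed
  have "dirac (\<lambda>y. cvec (g y)) x =
      (1 / \<phi> x) *\<^sub>R dirac U x + (- 1 / (\<phi> x)^2) *\<^sub>R (\<Sum>j\<in>UNIV. d $ j *\<^sub>R cmult (cgen j) (U x))"
    unfolding dirac_def dg cmult_add_right cmult_scaleR_right sum.distrib scaleR_sum_right scaleR_scaleR
    by simp
  also have "(\<Sum>j\<in>UNIV. d $ j *\<^sub>R cmult (cgen j) (U x)) = csc (- (d \<bullet> d))"
    unfolding cmult_cvec_left[symmetric] Ux by (rule cmult_cvec_self)
  also have "(- 1 / (\<phi> x)^2) *\<^sub>R csc (- (d \<bullet> d)) = csc (g x \<bullet> g x)"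
    using nz unfolding gx by (simp add: csc_scaleR power2_eq_square)
  finally show ?thesis unfolding U_def .
qed

text \<open>Pointwise, the auxiliary equation for \<open>\<phi>\<close> is the Riccati condition for its logarithmic
  derivative, multiplied by \<open>-\<phi>\<close>.\<close>

lemma aux_equation_iff_riccati_shift_at:
  fixes \<phi> :: "('n::{finite,linorder}) rvec \<Rightarrow> real" and g h :: "'n rvec \<Rightarrow> 'n rvec"
  assumes S: "open S" "x \<in> S" and nz: "\<phi> x \<noteq> 0"
    and p: "\<And>j. has_partial (cscf \<phi>) j x" and pp: "\<And>j. has_partial (dirac (cscf \<phi>)) j x"
    and g: "\<And>y. y \<in> S \<Longrightarrow> cvec (g y) = (1 / \<phi> y) *\<^sub>R dirac (cscf \<phi>) y"
  shows "claplace \<phi> x + csc (2 * cinner (dirac (cscf \<phi>) x) (cvec (h x))) = 0 \<longleftrightarrow>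
    dirac (\<lambda>y. cvec (g y)) x = csc (g x \<bullet> g x + 2 * (g x \<bullet> h x))"
proof -
  have "dirac (cscf \<phi>) x = \<phi> x *\<^sub>R cvec (g x)" using g[OF S(2)] nz by simp
  then have "cinner (dirac (cscf \<phi>) x) (cvec (h x)) = \<phi> x * (g x \<bullet> h x)"
    by (simp add: cvec_scaleR[symmetric] cinner_cvec)
  then have "claplace \<phi> x + csc (2 * cinner (dirac (cscf \<phi>) x) (cvec (h x))) = 0 \<longleftrightarrow>
      dirac (dirac (cscf \<phi>)) x = \<phi> x *\<^sub>R csc (2 * (g x \<bullet> h x))"
    by (auto simp: claplace_def add_eq_0_iff2 csc_scaleR algebra_simps)
  also have "\<dots> \<longleftrightarrow> (1 / \<phi> x) *\<^sub>R dirac (dirac (cscf \<phi>)) x = csc (2 * (g x \<bullet> h x))"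
  proof
    assume "dirac (dirac (cscf \<phi>)) x = \<phi> x *\<^sub>R csc (2 * (g x \<bullet> h x))"
    then show "(1 / \<phi> x) *\<^sub>R dirac (dirac (cscf \<phi>)) x = csc (2 * (g x \<bullet> h x))" using nz by simp
  next
    assume "(1 / \<phi> x) *\<^sub>R dirac (dirac (cscf \<phi>)) x = csc (2 * (g x \<bullet> h x))"
    then have "\<phi> x *\<^sub>R (1 / \<phi> x) *\<^sub>R dirac (dirac (cscf \<phi>)) x = \<phi> x *\<^sub>R csc (2 * (g x \<bullet> h x))"
      by simp
    then show "dirac (dirac (cscf \<phi>)) x = \<phi> x *\<^sub>R csc (2 * (g x \<bullet> h x))" using nz by simp
  qed
  also have "\<dots> \<longleftrightarrow>
      (1 / \<phi> x) *\<^sub>R dirac (dirac (cscf \<phi>)) x + csc (g x \<bullet> g x) = csc (2 * (g x \<bullet> h x)) + csc (g x \<bullet> g x)"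
    by (rule add_right_cancel[symmetric])
  also have "\<dots> \<longleftrightarrow> dirac (\<lambda>y. cvec (g y)) x = csc (g x \<bullet> g x + 2 * (g x \<bullet> h x))"
    using dirac_log_derivative[OF assms] by (simp add: csc_add[symmetric] ac_simps)
  finally show ?thesis .
qed

lemma aux_solution_iff_riccati_shift:
  fixes \<phi> :: "('n::{finite,linorder}) rvec \<Rightarrow> real" and g h :: "'n rvec \<Rightarrow> 'n rvec"
  assumes "open \<Omega>" and "\<forall>x\<in>\<Omega>. \<phi> x \<noteq> 0"
    and "\<forall>x\<in>\<Omega>. \<forall>j. has_partial (cscf \<phi>) j x" "\<forall>x\<in>\<Omega>. \<forall>j. has_partial (dirac (cscf \<phi>)) j x"
    and "\<forall>x\<in>\<Omega>. cvec (g x) = (1 / \<phi> x) *\<^sub>R dirac (cscf \<phi>) x"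
  shows "aux_solution \<Omega> h \<phi> \<longleftrightarrow> (\<forall>x\<in>\<Omega>. dirac (\<lambda>y. cvec (g y)) x = csc (g x \<bullet> g x + 2 * (g x \<bullet> h x)))"
  using aux_equation_iff_riccati_shift_at[OF assms(1)] assms(2-) unfolding aux_solution_def by blast

lemma exp_potential_log_derivative:
  fixes g :: "('n::{finite,linorder}) rvec \<Rightarrow> 'n rvec"
  assumes "open \<Omega>" and gd: "g differentiable_on \<Omega>" and \<psi>: "potential_on \<psi> g \<Omega>"
  defines "\<phi> \<equiv> \<lambda>y. exp (\<psi> y)"
  shows "\<forall>x\<in>\<Omega>. \<forall>j. has_partial (cscf \<phi>) j x" "\<forall>x\<in>\<Omega>. \<forall>j. has_partial (dirac (cscf \<phi>)) j x"
    "\<forall>x\<in>\<Omega>. cvec (g x) = (1 / \<phi> x) *\<^sub>R dirac (cscf \<phi>) x"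
proof -
  have d\<phi>: "(\<phi> has_derivative (\<lambda>h. (\<phi> x *\<^sub>R g x) \<bullet> h)) (at x)" if "x \<in> \<Omega>" for x
    using \<psi> that unfolding potential_on_def \<phi>_def by (auto intro!: derivative_eq_intros)
  have p: "has_partial (cscf \<phi>) j x" and U: "dirac (cscf \<phi>) x = \<phi> x *\<^sub>R cvec (g x)"
    if "x \<in> \<Omega>" for x j
    using dirac_cscf_if_has_derivative[OF d\<phi>[OF that]] by (simp_all add: cvec_scaleR)
  show "\<forall>x\<in>\<Omega>. \<forall>j. has_partial (cscf \<phi>) j x" using p by blast
  show "\<forall>x\<in>\<Omega>. cvec (g x) = (1 / \<phi> x) *\<^sub>R dirac (cscf \<phi>) x" using U by (simp add: \<phi>_def)
  have "has_partial (dirac (cscf \<phi>)) j x" if x: "x \<in> \<Omega>" for x j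
  proof -
    have "((\<lambda>y. \<phi> y *\<^sub>R cvec (g y)) has_derivative
        (\<lambda>k. (\<phi> x * (g x \<bullet> k)) *\<^sub>R cvec (g x) + \<phi> x *\<^sub>R cvec (frechet_derivative g (at x) k))) (at x)"
      using d\<phi>[OF x]
        bounded_linear.has_derivative[OF bounded_linear_cvec has_derivative_frechet_derivative_on_open[OF assms(1) gd x]]
      by (auto intro!: derivative_eq_intros)
    moreover have "has_partial (dirac (cscf \<phi>)) j x = has_partial (\<lambda>y. \<phi> y *\<^sub>R cvec (g y)) j x"
      by (rule partial_cong(1)[OF assms(1) x]) (rule U)
    ultimately show ?thesis
      using partial_if_has_derivative(1) by blast
  qed
  then show "\<forall>x\<in>\<Omega>. \<forall>j. has_partial (dirac (cscf \<phi>)) j x" by blast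
qed

lemma log_derivative_exists:
  fixes g :: "('n::{finite,linorder}) rvec \<Rightarrow> 'n rvec"
  assumes "open \<Omega>" "simply_connected \<Omega>" "g differentiable_on \<Omega>"
    and scalar: "\<And>x. x \<in> \<Omega> \<Longrightarrow> dirac (\<lambda>y. cvec (g y)) x = csc (r x)"
  obtains \<phi> where "\<forall>x\<in>\<Omega>. \<phi> x \<noteq> 0"
    "\<forall>x\<in>\<Omega>. \<forall>j. has_partial (cscf \<phi>) j x" "\<forall>x\<in>\<Omega>. \<forall>j. has_partial (dirac (cscf \<phi>)) j x"
    "\<forall>x\<in>\<Omega>. cvec (g x) = (1 / \<phi> x) *\<^sub>R dirac (cscf \<phi>) x"
proof -
  interpret curl_free_field \<Omega> g
    using assms(1) curl_free_on_if_dirac_scalar[OF assms(1,3) scalar] by unfold_locales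
  obtain \<psi> where "potential_on \<psi> g \<Omega>" using global_potential[OF assms(2)] .
  from exp_potential_log_derivative[OF assms(1,3) this] show ?thesis
    by (intro that[of "\<lambda>y. exp (\<psi> y)"]) auto
qed

theorem proposition5p1:
  fixes \<Omega> :: "('n::{finite,linorder}) rvec set"
    and v :: "'n rvec \<Rightarrow> real"
    and h g :: "'n rvec \<Rightarrow> 'n rvec"
  assumes "CARD('n) > 1"
    and "open \<Omega>" and "connected \<Omega>" and "\<Omega> \<noteq> {}" and "simply_connected \<Omega>"
    and "riccati_solution \<Omega> v h"
    and "g differentiable_on \<Omega>"
  shows "riccati_solution \<Omega> v (\<lambda>x. g x + h x) \<longleftrightarrow>
    (\<exists>\<phi>. aux_solution \<Omega> h \<phi> \<and> (\<forall>x\<in>\<Omega>. \<phi> x \<noteq> 0) \<and>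
         (\<forall>x\<in>\<Omega>. cvec (g x) = (1 / \<phi> x) *\<^sub>R dirac (cscf \<phi>) x))"
proof -
  have shift: "riccati_solution \<Omega> v (\<lambda>x. g x + h x) \<longleftrightarrow>
      (\<forall>x\<in>\<Omega>. dirac (\<lambda>y. cvec (g y)) x = csc (g x \<bullet> g x + 2 * (g x \<bullet> h x)))"
    using riccati_solution_shift_iff assms(2,6,7) by blast
  show ?thesis
  proof
    assume "riccati_solution \<Omega> v (\<lambda>x. g x + h x)"
    then have eq: "\<forall>x\<in>\<Omega>. dirac (\<lambda>y. cvec (g y)) x = csc (g x \<bullet> g x + 2 * (g x \<bullet> h x))"
      using shift by blast
    then obtain \<phi> where "\<forall>x\<in>\<Omega>. \<phi> x \<noteq> 0" and \<phi>: "\<forall>x\<in>\<Omega>. \<forall>j. has_partial (cscf \<phi>) j x"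
      "\<forall>x\<in>\<Omega>. \<forall>j. has_partial (dirac (cscf \<phi>)) j x" "\<forall>x\<in>\<Omega>. cvec (g x) = (1 / \<phi> x) *\<^sub>R dirac (cscf \<phi>) x"
      using log_derivative_exists[OF assms(2,5,7), where r="\<lambda>x. g x \<bullet> g x + 2 * (g x \<bullet> h x)"] by blast
    with aux_solution_iff_riccati_shift[OF assms(2)] eq show "\<exists>\<phi>. aux_solution \<Omega> h \<phi> \<and>
        (\<forall>x\<in>\<Omega>. \<phi> x \<noteq> 0) \<and> (\<forall>x\<in>\<Omega>. cvec (g x) = (1 / \<phi> x) *\<^sub>R dirac (cscf \<phi>) x)"
      by blast
  next
    assume "\<exists>\<phi>. aux_solution \<Omega> h \<phi> \<and> (\<forall>x\<in>\<Omega>. \<phi> x \<noteq> 0) \<and>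
        (\<forall>x\<in>\<Omega>. cvec (g x) = (1 / \<phi> x) *\<^sub>R dirac (cscf \<phi>) x)"
    then obtain \<phi> where aux: "aux_solution \<Omega> h \<phi>" and "\<forall>x\<in>\<Omega>. \<phi> x \<noteq> 0"
      "\<forall>x\<in>\<Omega>. cvec (g x) = (1 / \<phi> x) *\<^sub>R dirac (cscf \<phi>) x" by blast
    moreover have "\<forall>x\<in>\<Omega>. \<forall>j. has_partial (cscf \<phi>) j x" "\<forall>x\<in>\<Omega>. \<forall>j. has_partial (dirac (cscf \<phi>)) j x"
      using aux unfolding aux_solution_def by blast+
    ultimately show "riccati_solution \<Omega> v (\<lambda>x. g x + h x)"
      using aux_solution_iff_riccati_shift[OF assms(2)] shift by blast
  qed
qed

end
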